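(* Let $G$ be an extension of an M-closed 2-edge-coloured graph. Then $G$ is supereulerian if and only if $G$ is trail-colour-connected and has an eulerian factor.
   Context: Graphs are finite, undirected, without loops, and may contain parallel edges. A 2-edge-coloured graph is a graph $G=(V,E)$ with a colouring $\phi:E\to\{1,2\}$. A trail is a walk that uses no edge more than once. A walk or trail is alternating if consecutive edges have different colours; for a closed alternating walk or trail the first and last edges must also have different colours (so it has at least two edges). A closed trail is spanning if it visits every vertex. A 2-edge-coloured graph is M-closed if, whenever some vertex $u$ is joined to two distinct vertices $x,z$ by edges of the same colour, $xz$ is an edge of the graph (of any colour). An extension of a 2-edge-coloured graph $G_0$ on $n>1$ vertices $v_1,\dots,v_n$ is any graph obtained by replacing each $v_i$ by an independent set $\{v_{i,1},\dots,v_{i,p_i}\}$ with $p_i\ge 1$ and, for every edge $v_iv_j$ of $G_0$ of colour $c$, including an edge of colour $c$ between $v_{i,q}$ and $v_{j,r}$ for all $q\in\{1,\dots,p_i\}$, $r\in\{1,\dots,p_j\}$ (there are no other edges). A 2-edge-coloured graph $G$ is supereulerian if it contains a spanning closed alternating trail. An eulerian factor of $G$ is a collection of vertex-disjoint induced subgraphs $G_1,\dots,G_k$ ($k\ge 1$) of $G$ whose vertex sets cover $V(G)$ and each of which is supereulerian. $G$ is trail-colour-connected if for every pair of distinct vertices $u,v$ it contains two alternating $(u,v)$-trails $T_1,T_2$ whose union is a closed alternating walk (i.e. $T_1$ and $T_2$ have first edges of different colours at $u$ and last edges of different colours at $v$). *)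

theory Defs
  imports "HOL-Library.Disjoint_Sets"
begin

text \<open>
  Finite undirected loopless multigraphs with edges coloured 1 and 2. The edges are objects of
  their own, so that parallel edges (of equal or of different colours) are possible.
\<close>

record ('v, 'e) coloured_graph =
  verts :: "'v set"
  edges :: "'e set"
  ends :: "'e \<Rightarrow> 'v set"
  colour :: "'e \<Rightarrow> nat"

definition two_edge_coloured_graph :: "('v, 'e) coloured_graph \<Rightarrow> bool" where
  "two_edge_coloured_graph G \<longleftrightarrow>
     finite (verts G) \<and> finite (edges G) \<and>
     (\<forall>e\<in>edges G. ends G e \<subseteq> verts G \<and> card (ends G e) = 2 \<and> colour G e \<in> {1, 2})"

text \<open>
  The walk \<open>v\<^sub>0 e\<^sub>1 v\<^sub>1 \<dots> e\<^sub>k v\<^sub>k\<close> is given by its vertex list and its edge list.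
\<close>

definition walk :: "('v, 'e) coloured_graph \<Rightarrow> 'v list \<Rightarrow> 'e list \<Rightarrow> bool" where
  "walk G vs es \<longleftrightarrow>
     length vs = Suc (length es) \<and> set vs \<subseteq> verts G \<and> set es \<subseteq> edges G \<and>
     (\<forall>i<length es. ends G (es ! i) = {vs ! i, vs ! Suc i})"

definition trail :: "('v, 'e) coloured_graph \<Rightarrow> 'v list \<Rightarrow> 'e list \<Rightarrow> bool" where
  "trail G vs es \<longleftrightarrow> walk G vs es \<and> distinct es"

definition alternating :: "('v, 'e) coloured_graph \<Rightarrow> 'e list \<Rightarrow> bool" where
  "alternating G es \<longleftrightarrow>
     (\<forall>i. Suc i < length es \<longrightarrow> colour G (es ! i) \<noteq> colour G (es ! Suc i))"

definition alternating_trail ::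
  "('v, 'e) coloured_graph \<Rightarrow> 'v \<Rightarrow> 'v \<Rightarrow> 'v list \<Rightarrow> 'e list \<Rightarrow> bool" where
  "alternating_trail G u v vs es \<longleftrightarrow>
     trail G vs es \<and> alternating G es \<and> hd vs = u \<and> last vs = v"

text \<open>A single vertex without edges is not a closed alternating trail.\<close>

definition closed_alternating_trail ::
  "('v, 'e) coloured_graph \<Rightarrow> 'v list \<Rightarrow> 'e list \<Rightarrow> bool" where
  "closed_alternating_trail G vs es \<longleftrightarrow>
     trail G vs es \<and> alternating G es \<and> hd vs = last vs \<and>
     es \<noteq> [] \<and> colour G (hd es) \<noteq> colour G (last es)"

definition supereulerian :: "('v, 'e) coloured_graph \<Rightarrow> bool" where
  "supereulerian G \<longleftrightarrow> (\<exists>vs es. closed_alternating_trail G vs es \<and> set vs = verts G)"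

definition induced_subgraph ::
  "('v, 'e) coloured_graph \<Rightarrow> 'v set \<Rightarrow> ('v, 'e) coloured_graph" where
  "induced_subgraph G X = G\<lparr>verts := X, edges := {e \<in> edges G. ends G e \<subseteq> X}\<rparr>"

text \<open>An eulerian factor is given by the vertex sets of its induced subgraphs.\<close>

definition eulerian_factor :: "('v, 'e) coloured_graph \<Rightarrow> 'v set set \<Rightarrow> bool" where
  "eulerian_factor G P \<longleftrightarrow>
     finite P \<and> P \<noteq> {} \<and> disjoint P \<and> \<Union>P = verts G \<and>
     (\<forall>X\<in>P. supereulerian (induced_subgraph G X))"

definition trail_colour_connected :: "('v, 'e) coloured_graph \<Rightarrow> bool" where
  "trail_colour_connected G \<longleftrightarrow>
     (\<forall>u\<in>verts G. \<forall>v\<in>verts G. u \<noteq> v \<longrightarrow>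
        (\<exists>vs\<^sub>1 es\<^sub>1 vs\<^sub>2 es\<^sub>2.
           alternating_trail G u v vs\<^sub>1 es\<^sub>1 \<and> alternating_trail G u v vs\<^sub>2 es\<^sub>2 \<and>
           colour G (hd es\<^sub>1) \<noteq> colour G (hd es\<^sub>2) \<and>
           colour G (last es\<^sub>1) \<noteq> colour G (last es\<^sub>2)))"

definition M_closed :: "('v, 'e) coloured_graph \<Rightarrow> bool" where
  "M_closed G \<longleftrightarrow>
     (\<forall>u x z. \<forall>e\<in>edges G. \<forall>f\<in>edges G.
        x \<noteq> z \<and> ends G e = {u, x} \<and> ends G f = {u, z} \<and> colour G e = colour G f \<longrightarrow>
        (\<exists>g\<in>edges G. ends G g = {x, z}))"

text \<open>
  \<open>G\<close> is an extension of \<open>H\<close>, up to the names of vertices and edges: the map \<open>\<pi>\<close> sends each copy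
  \<open>v\<^bsub>i,q\<^esub>\<close> to \<open>v\<^sub>i\<close>, so the fibres of \<open>\<pi>\<close> are the sets replacing the vertices of \<open>H\<close>, and \<open>\<eta>\<close> sends
  each edge of \<open>G\<close> to the edge of \<open>H\<close> from which it arises. Every edge of \<open>H\<close> contributes exactly one
  edge between any two copies of its ends, so multiplicities of parallel edges are kept. The fibres
  are independent because \<open>\<pi> ` ends G e\<close> has to be the two-element set \<open>ends H (\<eta> e)\<close>.
\<close>

definition extension_of ::
  "('v, 'e) coloured_graph \<Rightarrow> ('w, 'f) coloured_graph \<Rightarrow> bool" where
  "extension_of G H \<longleftrightarrow>
     card (verts H) > 1 \<and>
     (\<exists>\<pi> \<eta>. \<pi> ` verts G = verts H \<and>
        (\<forall>e\<in>edges G. \<eta> e \<in> edges H \<and> \<pi> ` ends G e = ends H (\<eta> e) \<and>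
                      colour G e = colour H (\<eta> e)) \<and>
        (\<forall>f\<in>edges H. \<forall>x\<in>verts G. \<forall>y\<in>verts G. ends H f = {\<pi> x, \<pi> y} \<longrightarrow>
           (\<exists>!e. e \<in> edges G \<and> \<eta> e = f \<and> ends G e = {x, y})))"

end

theory Submission
  imports Defs
begin

text \<open>
  Sufficiency: take an eulerian factor with the least number of parts and, in each part, a spanning
  closed alternating trail. Then no closed alternating trail spans the union of several parts. Between
  two parts \<open>X\<close> and \<open>Y\<close> the edges, directed from \<open>X\<close> to \<open>Y\<close> in colour 1 and from \<open>Y\<close> to \<open>X\<close> in colour 2,
  form no directed cycle, so if there is such an edge, then some vertex meets them in one colour only.
  M-closedness carries this around the trails: one of the parts, say \<open>X\<close>, is completely joined to \<open>Y\<close>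
  in such a way that the colour of an edge depends only on its end in \<open>X\<close>, and this colour alternates
  along the trail of \<open>X\<close>. Write \<open>X < Y\<close> in this case; the colours at \<open>X\<close> are the same for all such \<open>Y\<close>,
  and \<open><\<close> is a strict order. If \<open>X\<close> is minimal and \<open>x \<in> X\<close> is joined to the other parts in colour \<open>c\<close>,
  then an alternating trail that leaves \<open>x\<close> in the colour other than \<open>c\<close> never leaves \<open>X\<close>, so
  trail-colour-connectedness leaves only one part.
\<close>

section \<open>Closed alternating trails as cyclic lists of darts\<close>

text \<open>An edge together with a direction of traversal. Closed trails become lists of darts in
  which the first vertex is not repeated, so that changing the starting point is a rotation and
  changing the orientation is \<open>rev\<close> with \<open>flip\<close>.\<close>

type_synonym ('v, 'e) dart = "'v \<times> 'e \<times> 'v"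

abbreviation dtail :: "('v, 'e) dart \<Rightarrow> 'v" where "dtail d \<equiv> fst d"
abbreviation dedge :: "('v, 'e) dart \<Rightarrow> 'e" where "dedge d \<equiv> fst (snd d)"
abbreviation dhead :: "('v, 'e) dart \<Rightarrow> 'v" where "dhead d \<equiv> snd (snd d)"
abbreviation flip :: "('v, 'e) dart \<Rightarrow> ('v, 'e) dart" where "flip d \<equiv> (dhead d, dedge d, dtail d)"

definition dart :: "('v, 'e) coloured_graph \<Rightarrow> ('v, 'e) dart \<Rightarrow> bool" where
  "dart G d \<longleftrightarrow> dedge d \<in> edges G \<and> ends G (dedge d) = {dtail d, dhead d}"

definition link :: "('v, 'e) coloured_graph \<Rightarrow> ('v, 'e) dart \<Rightarrow> ('v, 'e) dart \<Rightarrow> bool" where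
  "link G d d' \<longleftrightarrow> dhead d = dtail d' \<and> colour G (dedge d) \<noteq> colour G (dedge d')"

text \<open>Edges are distinct, vertices may recur. A single dart is excluded because
  \<open>link\<close> would demand a colour different from itself.\<close>

definition tour :: "('v, 'e) coloured_graph \<Rightarrow> ('v, 'e) dart list \<Rightarrow> bool" where
  "tour G ds \<longleftrightarrow> ds \<noteq> [] \<and> (\<forall>d\<in>set ds. dart G d) \<and> distinct (map dedge ds) \<and>
     successively (link G) ds \<and> link G (last ds) (hd ds)"

text \<open>The order is forgotten: merging arguments only need the vertices visited and the edges
  spent.\<close>

definition tour_on :: "('v, 'e) coloured_graph \<Rightarrow> 'v set \<Rightarrow> 'e set \<Rightarrow> bool" where
  "tour_on G X E \<longleftrightarrow> (\<exists>ds. tour G ds \<and> X = dtail ` set ds \<and> E = dedge ` set ds)"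

definition adj :: "('v, 'e) coloured_graph \<Rightarrow> nat \<Rightarrow> 'v \<Rightarrow> 'v \<Rightarrow> bool" where
  "adj G c x y \<longleftrightarrow> (\<exists>e\<in>edges G. ends G e = {x, y} \<and> colour G e = c)"

lemma adj_sym: "adj G c x y \<longleftrightarrow> adj G c y x"
  by (simp add: adj_def insert_commute)

lemma tour_rotate: "tour G (as @ bs) \<Longrightarrow> tour G (bs @ as)"
  by (cases "as = []"; cases "bs = []")
    (auto simp: tour_def successively_append_iff)

lemma tour_rev: "tour G ds \<Longrightarrow> tour G (rev (map flip ds))"
proof -
  assume t: "tour G ds"
  have "successively (link G) (rev (map flip ds))"
    unfolding successively_rev successively_map
    by (rule successively_mono[of "link G"]) (use t in \<open>auto simp: tour_def link_def\<close>)
  moreover have "distinct (map dedge (rev (map flip ds)))"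
    using t by (simp add: tour_def rev_map[symmetric] comp_def)
  ultimately show ?thesis
    using t by (auto simp: tour_def dart_def link_def last_rev hd_rev hd_map last_map insert_commute)
qed

lemma tour_tails_heads:
  fixes G :: "('v, 'e) coloured_graph"
  assumes t: "tour G ds"
  shows "dhead ` set ds = dtail ` set ds"
proof -
  \<comment> \<open>In an open chain the tails and the heads differ at most by the first tail and
    the last head, and these coincide in a tour.\<close>
  have *: "insert b (dhead ` set ds) = insert (dhead (last ds)) (dtail ` set ds)"
    if "successively (link G) ds" "ds \<noteq> []" "b = dtail (hd ds)" for ds :: "('v, 'e) dart list" and b
    using that
  proof (induction ds arbitrary: b rule: induct_list012)
    case (3 d d' ds)
    then have "insert (dtail d') (dhead ` set (d' # ds)) =
        insert (dhead (last (d' # ds))) (dtail ` set (d' # ds))" by simp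
    moreover have "dhead d = dtail d'" using 3 by (simp add: link_def)
    ultimately show ?case using 3(5) by auto
  qed auto
  from t have "dtail (hd ds) \<in> dtail ` set ds" "dhead (last ds) \<in> dhead ` set ds"
    "dhead (last ds) = dtail (hd ds)"
    unfolding tour_def link_def by (blast intro: hd_in_set last_in_set)+
  moreover have "insert (dtail (hd ds)) (dhead ` set ds) = insert (dhead (last ds)) (dtail ` set ds)"
    using t by (intro *) (auto simp: tour_def)
  ultimately show ?thesis by (simp add: insert_absorb)
qed

lemma tour_rotate_to:
  assumes "tour G ds" "d \<in> set ds"
  obtains ds' where "tour G (d # ds')" "set (d # ds') = set ds"
proof -
  from assms(2) obtain as bs where "ds = as @ d # bs" by (meson split_list)
  with tour_rotate[of G as "d # bs"] assms(1) have "tour G (d # bs @ as)" by simp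
  then show ?thesis using that[of "bs @ as"] \<open>ds = _\<close> by auto
qed

text \<open>The direction of \<open>e\<close> may be prescribed: if the tour runs through
  \<open>e\<close> the other way, it is reversed before it is rotated.\<close>

lemma tour_on_start_edge:
  assumes "tour_on G X E" "e \<in> E" "ends G e = {x, x'}"
  obtains ds where "tour G ((x, e, x') # ds)" "X = insert x (dtail ` set ds)"
    "E = insert e (dedge ` set ds)"
proof -
  from assms obtain ds where ds: "tour G ds" "X = dtail ` set ds" "E = dedge ` set ds"
    by (auto simp: tour_on_def)
  with assms(2) obtain d where d: "d \<in> set ds" "dedge d = e" by auto
  then have "dart G d" using ds by (auto simp: tour_def)
  then have "{dtail d, dhead d} = {x, x'}" using d assms(3) by (simp add: dart_def)
  then consider "d = (x, e, x')" | "d = (x', e, x)" using d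
    by (cases d) (auto simp: doubleton_eq_iff)
  then show ?thesis
  proof cases
    case 1
    then obtain ds' where ds': "tour G ((x, e, x') # ds')" "set ((x, e, x') # ds') = set ds"
      using tour_rotate_to[OF ds(1) d(1)] by blast
    then have "X = dtail ` set ((x, e, x') # ds')" "E = dedge ` set ((x, e, x') # ds')"
      by (simp_all only: ds'(2) ds)
    then show ?thesis using that[of ds'] ds'(1) by simp
  next
    case 2
    let ?r = "rev (map flip ds)"
    have r: "tour G ?r" using ds tour_rev by blast
    have "dtail ` set ?r = X" using ds tour_tails_heads[of G ds] by (simp add: image_image)
    moreover have "dedge ` set ?r = E" using ds by (simp add: image_image)
    moreover have "flip d \<in> flip ` set ds" using d by (rule_tac imageI) simp
    then have "(x, e, x') \<in> set ?r" using 2 by simp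
    then obtain ds' where ds': "tour G ((x, e, x') # ds')" "set ((x, e, x') # ds') = set ?r"
      using tour_rotate_to[OF r] by blast
    ultimately have "X = dtail ` set ((x, e, x') # ds')" "E = dedge ` set ((x, e, x') # ds')"
      by (simp_all only: ds'(2))
    then show ?thesis using that[of ds'] ds'(1) by simp
  qed
qed

lemma tour_on_edge:
  assumes "tour_on G X E" "e \<in> E"
  obtains x x' where "e \<in> edges G" "ends G e = {x, x'}" "x \<in> X" "x' \<in> X"
proof -
  from assms obtain ds where ds: "tour G ds" "X = dtail ` set ds" "E = dedge ` set ds"
    by (auto simp: tour_on_def)
  with assms(2) obtain d where d: "d \<in> set ds" "dedge d = e" by auto
  then have "dhead d \<in> X" using tour_tails_heads[OF ds(1)] ds by blast
  with d ds show ?thesis by (intro that[of "dtail d" "dhead d"]) (auto simp: tour_def dart_def)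
qed

text \<open>\<open>I x c\<close> speaks of being at \<open>x\<close> and leaving it in colour
  \<open>c\<close>. The step ranges over all admissible colours in \<open>C\<close> rather than over
  the actual next dart, so it concerns one dart at a time.\<close>

lemma successively_link_forall:
  assumes "successively (link G) ds" "ds \<noteq> []"
    and "I (dtail (hd ds)) (colour G (dedge (hd ds)))"
    and "\<And>d c. d \<in> set ds \<Longrightarrow> I (dtail d) (colour G (dedge d)) \<Longrightarrow> c \<in> C \<Longrightarrow>
           c \<noteq> colour G (dedge d) \<Longrightarrow> I (dhead d) c"
    and "\<And>d. d \<in> set ds \<Longrightarrow> colour G (dedge d) \<in> C"
  shows "\<forall>d\<in>set ds. I (dtail d) (colour G (dedge d))"
  using assms
proof (induction ds rule: induct_list012)
  case (3 d d' ds)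
  have l: "link G d d'" using 3(3) by simp
  have "I (dhead d) (colour G (dedge d'))"
    using 3(5) l by (intro 3(6)[of d] 3(7)) (auto simp: link_def)
  then have "I (dtail d') (colour G (dedge d'))" using l by (simp add: link_def)
  then have "\<forall>d\<in>set (d' # ds). I (dtail d) (colour G (dedge d))"
    using 3(3,6,7) by (intro 3(2)) auto
  then show ?case using 3(5) by simp
qed auto

section \<open>Translation between lists of darts and pairs of a vertex list and an edge
  list\<close>

lemma open_darts_alternating_trail:
  assumes "\<forall>d\<in>set ds. dart G d" "distinct (map dedge ds)" "successively (link G) ds" "ds \<noteq> []"
    and "two_edge_coloured_graph G"
  shows "alternating_trail G (dtail (hd ds)) (dhead (last ds))
           (dtail (hd ds) # map dhead ds) (map dedge ds)"
proof -
  have e: "ends G (dedge d) = {dtail d, dhead d}" "dedge d \<in> edges G"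
    "dtail d \<in> verts G" "dhead d \<in> verts G" if "d \<in> set ds" for d
    using assms(1,5) that by (auto simp: dart_def two_edge_coloured_graph_def)
  have l: "link G (ds ! i) (ds ! Suc i)" if "Suc i < length ds" for i
    using assms(3) that by (simp add: successively_conv_nth)
  have "ends G (map dedge ds ! i) =
      {(dtail (hd ds) # map dhead ds) ! i, (dtail (hd ds) # map dhead ds) ! Suc i}"
    if i: "i < length ds" for i
  proof (cases i)
    case 0
    then show ?thesis using e(1)[of "ds ! 0"] i assms(4) by (simp add: hd_conv_nth)
  next
    case (Suc k)
    then show ?thesis using e(1)[of "ds ! i"] l[of k] i by (simp add: link_def)
  qed
  moreover have "alternating G (map dedge ds)"
    using l by (auto simp: alternating_def link_def)
  ultimately show ?thesis
    using e assms(2,4)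
    by (auto simp: alternating_trail_def trail_def walk_def last_map)
qed

lemma closed_alternating_trail_imp_tour:
  assumes "closed_alternating_trail G vs es"
  shows "tour_on G (set vs) (set es)"
proof -
  let ?n = "length es"
  let ?d = "\<lambda>i. (vs ! i, es ! i, vs ! Suc i)"
  let ?ds = "map ?d [0..<?n]"
  have w: "length vs = Suc ?n" "set es \<subseteq> edges G" "distinct es" "alternating G es"
    "\<And>i. i < ?n \<Longrightarrow> ends G (es ! i) = {vs ! i, vs ! Suc i}" "hd vs = last vs" "es \<noteq> []"
    "colour G (hd es) \<noteq> colour G (last es)"
    using assms by (auto simp: closed_alternating_trail_def trail_def walk_def)
  have n: "?n > 0" using w by simp
  have "link G (last ?ds) (hd ?ds)"
    using w n by (auto simp: link_def last_map hd_map hd_conv_nth last_conv_nth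
        simp flip: length_greater_0_conv)
  moreover have "map dedge ?ds = es" by (simp add: comp_def map_nth)
  moreover have "successively (link G) ?ds"
    using w by (auto simp: successively_conv_nth link_def alternating_def)
  ultimately have "tour G ?ds"
    using w n by (auto simp: tour_def dart_def)
  \<comment> \<open>The tails omit the last entry of \<open>vs\<close>, which equals the
    first.\<close>
  moreover have "dtail ` set ?ds = set vs"
  proof -
    have "dtail ` set ?ds = (!) vs ` {..<?n}" by (force simp: image_image)
    moreover have "set vs = (!) vs ` {..<Suc ?n}"
      using w(1) by (metis lessThan_atLeast0 list.set_map map_nth set_upt)
    moreover have "vs ! ?n = vs ! 0"
      using w(1,6) by (metis Zero_not_Suc diff_Suc_1 hd_conv_nth last_conv_nth list.size(3))
    ultimately show ?thesis using n by (auto simp: lessThan_Suc)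
  qed
  moreover have "dedge ` set ?ds = set es"
    using \<open>map dedge ?ds = es\<close> by (metis list.set_map)
  ultimately show ?thesis unfolding tour_on_def by (metis (no_types, lifting))
qed

lemma tour_on_imp_closed_alternating_trail:
  assumes "tour_on G X E" "two_edge_coloured_graph G"
  obtains vs es where "closed_alternating_trail G vs es" "set vs = X" "set es = E"
proof -
  obtain ds where t: "tour G ds" "X = dtail ` set ds" "E = dedge ` set ds"
    using assms(1) by (auto simp: tour_on_def)
  let ?vs = "dtail (hd ds) # map dhead ds" and ?es = "map dedge ds"
  have "alternating_trail G (dtail (hd ds)) (dhead (last ds)) ?vs ?es"
    using t assms by (intro open_darts_alternating_trail) (auto simp: tour_def)
  then have "closed_alternating_trail G ?vs ?es"
    using t(1) by (auto simp: closed_alternating_trail_def alternating_trail_def tour_def link_def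
        hd_map last_map)
  moreover have "set ?vs = X"
    using tour_tails_heads[OF t(1)] t by (auto simp: tour_def)
  ultimately show ?thesis using that t by simp
qed

lemma supereulerian_iff_tour_on:
  assumes "two_edge_coloured_graph G"
  shows "supereulerian G \<longleftrightarrow> (\<exists>E. tour_on G (verts G) E)"
proof
  assume "supereulerian G"
  then obtain vs es where "closed_alternating_trail G vs es" "set vs = verts G"
    by (auto simp: supereulerian_def)
  with closed_alternating_trail_imp_tour[of G vs es]
  show "\<exists>E. tour_on G (verts G) E" by auto
next
  assume "\<exists>E. tour_on G (verts G) E"
  then obtain E where "tour_on G (verts G) E" ..
  then obtain vs es where "closed_alternating_trail G vs es" "set vs = verts G"
    using assms by (rule tour_on_imp_closed_alternating_trail)
  then show "supereulerian G" by (auto simp: supereulerian_def)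
qed

section \<open>Spanning tours of induced subgraphs\<close>

lemma two_edge_coloured_induced:
  "two_edge_coloured_graph G \<Longrightarrow> X \<subseteq> verts G \<Longrightarrow> two_edge_coloured_graph (induced_subgraph G X)"
  by (auto simp: two_edge_coloured_graph_def induced_subgraph_def intro: finite_subset)

text \<open>Heads and tails of a tour form the same set, so a tour with tails \<open>X\<close> only
  uses edges inside \<open>X\<close>. The parts of a factor can thus be studied in \<open>G\<close>
  itself.\<close>

lemma tour_on_induced:
  "tour_on (induced_subgraph G X) X E \<longleftrightarrow> tour_on G X E"
proof -
  have "tour (induced_subgraph G X) ds \<longleftrightarrow> tour G ds" if "X = dtail ` set ds" for ds
  proof -
    have l: "link (induced_subgraph G X) = link G"
      by (simp add: link_def fun_eq_iff induced_subgraph_def)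
    have "dart (induced_subgraph G X) d \<longleftrightarrow> dart G d \<and> dtail d \<in> X \<and> dhead d \<in> X" for d
      by (auto simp: dart_def induced_subgraph_def)
    then show ?thesis using tour_tails_heads[of G ds] that unfolding tour_def l by blast
  qed
  then show ?thesis by (auto simp: tour_on_def)
qed

lemma supereulerian_induced_iff:
  assumes "two_edge_coloured_graph G" "X \<subseteq> verts G"
  shows "supereulerian (induced_subgraph G X) \<longleftrightarrow> (\<exists>E. tour_on G X E)"
  using supereulerian_iff_tour_on[OF two_edge_coloured_induced[OF assms]] tour_on_induced[of G X]
  by (simp add: induced_subgraph_def)

section \<open>Necessity\<close>

text \<open>Occurrences of \<open>u\<close> and \<open>v\<close> cut the spanning tour into two
  arcs. One arc and the reverse of the other are the two trails; their end colours differ because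
  the tour alternates at both cuts.\<close>

lemma supereulerian_imp_connected:
  assumes G: "two_edge_coloured_graph G" and "supereulerian G"
  shows "trail_colour_connected G"
  unfolding trail_colour_connected_def
proof (intro ballI impI)
  fix u v assume uv: "u \<in> verts G" "v \<in> verts G" "u \<noteq> v"
  from assms obtain E ds0 where "tour G ds0" "verts G = dtail ` set ds0"
    unfolding supereulerian_iff_tour_on[OF G] tour_on_def by auto
  moreover then obtain d where d: "d \<in> set ds0" "dtail d = u" using uv by auto
  ultimately obtain ds where ds: "tour G (d # ds)" "verts G = dtail ` set (d # ds)"
    using tour_rotate_to by metis
  then obtain d' where "d' \<in> set ds" "dtail d' = v" using uv d by auto
  then obtain as bs where dv: "ds = as @ d' # bs" "dtail d' = v" by (meson split_list)
  let ?p = "d # as" and ?q = "rev (map flip (d' # bs))"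
  have t: "\<forall>x\<in>set (?p @ d' # bs). dart G x" "distinct (map dedge (?p @ d' # bs))"
    "successively (link G) (?p @ d' # bs)" "link G (last (d' # bs)) d"
    using ds(1) dv by (auto simp: tour_def)
  have "link G (last ?p) d'" "successively (link G) ?p" "successively (link G) (d' # bs)"
    using t(3) unfolding successively_append_iff by auto
  note s = this
  have ends: "dtail (hd ?p) = u" "dhead (last ?p) = v" "dtail (hd ?q) = u" "dhead (last ?q) = v"
    using d dv s(1) t(4) by (auto simp: link_def hd_rev last_map simp del: rev.simps(2) list.simps(9))
      (auto simp: last_rev)
  have "alternating_trail G (dtail (hd ?p)) (dhead (last ?p)) (dtail (hd ?p) # map dhead ?p) (map dedge ?p)"
    using t s G by (intro open_darts_alternating_trail) auto
  then have p: "alternating_trail G u v (u # map dhead ?p) (map dedge ?p)"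
    unfolding ends .
  have "alternating_trail G (dtail (hd ?q)) (dhead (last ?q)) (dtail (hd ?q) # map dhead ?q) (map dedge ?q)"
  proof (intro open_darts_alternating_trail)
    show "successively (link G) ?q"
      unfolding successively_rev successively_map
      using s(3) by (rule successively_mono) (auto simp: link_def)
    have "map dedge ?q = rev (map dedge (d' # bs))" by (simp add: rev_map comp_def)
    then show "distinct (map dedge ?q)" using t(2) by (simp del: rev.simps)
  qed (use t G in \<open>auto simp: dart_def insert_commute\<close>)
  then have q: "alternating_trail G u v (u # map dhead ?q) (map dedge ?q)"
    unfolding ends .
  have "colour G (hd (map dedge ?p)) \<noteq> colour G (hd (map dedge ?q))"
    using t(4) by (auto simp: link_def hd_map hd_rev last_map simp del: rev.simps(2))
  moreover have "colour G (last (map dedge ?p)) \<noteq> colour G (last (map dedge ?q))"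
    using s(1) by (auto simp: link_def last_map)
  ultimately show "\<exists>vs\<^sub>1 es\<^sub>1 vs\<^sub>2 es\<^sub>2.
           alternating_trail G u v vs\<^sub>1 es\<^sub>1 \<and> alternating_trail G u v vs\<^sub>2 es\<^sub>2 \<and>
           colour G (hd es\<^sub>1) \<noteq> colour G (hd es\<^sub>2) \<and>
           colour G (last es\<^sub>1) \<noteq> colour G (last es\<^sub>2)"
    using p q by blast
qed

lemma supereulerian_imp_factor:
  assumes G: "two_edge_coloured_graph G" and "supereulerian G"
  shows "eulerian_factor G {verts G}"
  using assms supereulerian_iff_tour_on[OF G] supereulerian_induced_iff[OF G]
  by (simp add: eulerian_factor_def)

section \<open>Merging closed alternating trails\<close>

lemma colour_cases:
  assumes "two_edge_coloured_graph G" "e \<in> edges G"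
  shows "colour G e = 1 \<or> colour G e = 2"
  using assms by (auto simp: two_edge_coloured_graph_def)

lemma tour_on_edges: "tour_on G X E \<Longrightarrow> e \<in> E \<Longrightarrow> e \<in> edges G"
  by (meson tour_on_edge)

lemma tour_on_ends: "tour_on G X E \<Longrightarrow> e \<in> E \<Longrightarrow> ends G e \<subseteq> X \<and> ends G e \<noteq> {}"
  by (erule tour_on_edge, assumption) simp

text \<open>A tour enters and leaves each of its vertices in different colours, so both colours
  occur there.\<close>

lemma tour_on_nbr:
  assumes G: "two_edge_coloured_graph G" and t: "tour_on G X E" and "x \<in> X" "c \<in> {1, 2}"
  obtains e x' where "e \<in> E" "ends G e = {x, x'}" "colour G e = c" "x' \<in> X"
proof -
  obtain ds where ds: "tour G ds" "X = dtail ` set ds" "E = dedge ` set ds"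
    using t by (auto simp: tour_on_def)
  then obtain d where d: "d \<in> set ds" "dtail d = x" using \<open>x \<in> X\<close> by auto
  obtain ds' where ds': "tour G (d # ds')" "set (d # ds') = set ds"
    using tour_rotate_to[OF ds(1) d(1)] by blast
  let ?l = "last (d # ds')"
  have l: "?l \<in> set ds" using ds'(2) last_in_set[of "d # ds'"] by simp
  have "link G ?l d" using ds'(1) by (simp add: tour_def)
  then have le: "dhead ?l = x" "colour G (dedge ?l) \<noteq> colour G (dedge d)"
    using d(2) by (auto simp: link_def)
  have E: "dedge d \<in> E" "dedge ?l \<in> E" "dart G d" "dart G ?l" using d l ds by (auto simp: tour_def)
  have X: "dhead d \<in> X" "dtail ?l \<in> X" using d l ds tour_tails_heads[OF ds(1)] by auto
  have "ends G (dedge d) = {x, dhead d}" "ends G (dedge ?l) = {x, dtail ?l}"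
    using E d(2) le by (auto simp: dart_def)
  moreover have "colour G (dedge d) = c \<or> colour G (dedge ?l) = c"
    using colour_cases[OF G tour_on_edges[OF t E(1)]] colour_cases[OF G tour_on_edges[OF t E(2)]]
      le(2) \<open>c \<in> {1, 2}\<close> by auto
  ultimately show ?thesis using that E X by blast
qed

lemma tour_on_start:
  assumes G: "two_edge_coloured_graph G" and t: "tour_on G X E" and "x \<in> X" "c \<in> {1, 2}"
  obtains ds where "tour G ds" "X = dtail ` set ds" "E = dedge ` set ds"
    "dtail (hd ds) = x" "colour G (dedge (hd ds)) = c"
proof -
  obtain e x' where e: "e \<in> E" "ends G e = {x, x'}" "colour G e = c" "x' \<in> X"
    using tour_on_nbr[OF assms] .
  obtain ds where "tour G ((x, e, x') # ds)" "X = insert x (dtail ` set ds)"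
    "E = insert e (dedge ` set ds)"
    using tour_on_start_edge[OF t e(1,2)] .
  with e(3) that[of "(x, e, x') # ds"] show ?thesis by simp
qed

text \<open>Induction once around the tour, where \<open>3 - c\<close> is the colour other than
  \<open>c\<close>: arriving in colour \<open>c\<close> means leaving in \<open>3 - c\<close>. The
  starting vertex and colour are free because the orientation is. The second conclusion orients each
  edge as it is traversed.\<close>

lemma tour_on_induct:
  assumes G: "two_edge_coloured_graph G" and t: "tour_on G X E" and x0: "x0 \<in> X" "c0 \<in> {1, 2}" "I x0 c0"
    and step: "\<And>e x x'. e \<in> E \<Longrightarrow> ends G e = {x, x'} \<Longrightarrow> x \<in> X \<Longrightarrow> x' \<in> X \<Longrightarrow> I x (colour G e) \<Longrightarrow>
      I x' (3 - colour G e)"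
  shows "\<forall>x\<in>X. \<exists>c\<in>{1, 2}. I x c"
    and "\<forall>e\<in>E. \<exists>x x'. ends G e = {x, x'} \<and> I x (colour G e) \<and> I x' (3 - colour G e)"
proof -
  obtain ds where ds: "tour G ds" "X = dtail ` set ds" "E = dedge ` set ds"
    "dtail (hd ds) = x0" "colour G (dedge (hd ds)) = c0"
    using tour_on_start[OF G t x0(1,2)] .
  have d: "dedge d \<in> E" "ends G (dedge d) = {dtail d, dhead d}" "dedge d \<in> edges G"
    "dtail d \<in> X" "dhead d \<in> X"
    if "d \<in> set ds" for d using that ds tour_tails_heads[OF ds(1)] by (auto simp: tour_def dart_def)
  have next': "I (dhead d) (3 - colour G (dedge d))" if "d \<in> set ds" "I (dtail d) (colour G (dedge d))" for d
    using step[OF d(1,2,4,5)] that by blast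
  have all: "\<forall>d\<in>set ds. I (dtail d) (colour G (dedge d))"
  proof (rule successively_link_forall[where C = "{1, 2}"])
    show "successively (link G) ds" "ds \<noteq> []" using ds by (auto simp: tour_def)
    show "I (dtail (hd ds)) (colour G (dedge (hd ds)))" using ds x0 by simp
    show c: "colour G (dedge d) \<in> {1, 2}" if "d \<in> set ds" for d
      using colour_cases[OF G] d(3) that by blast
    show "I (dhead d) c" if "d \<in> set ds" "I (dtail d) (colour G (dedge d))" "c \<in> {1, 2}"
      "c \<noteq> colour G (dedge d)" for d c
    proof -
      have "c = 3 - colour G (dedge d)" using that(3,4) c[OF that(1)] by auto
      then show ?thesis using next' that by simp
    qed
  qed
  show "\<forall>x\<in>X. \<exists>c\<in>{1, 2}. I x c" using all d(3) colour_cases[OF G] ds(2) by fastforce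
  show "\<forall>e\<in>E. \<exists>x x'. ends G e = {x, x'} \<and> I x (colour G e) \<and> I x' (3 - colour G e)"
    using all d(2) next' ds(3) by blast
qed

text \<open>Both tours are started at a common vertex in colour 1, so both return to it in colour 2
  and their concatenation alternates at the two junctions.\<close>

lemma tour_on_splice:
  assumes G: "two_edge_coloured_graph G" and "tour_on G X E" "tour_on G Y F" "E \<inter> F = {}" "X \<inter> Y \<noteq> {}"
  shows "tour_on G (X \<union> Y) (E \<union> F)"
proof -
  obtain z where z: "z \<in> X" "z \<in> Y" using assms by auto
  obtain as where as: "tour G as" "X = dtail ` set as" "E = dedge ` set as"
    "dtail (hd as) = z" "colour G (dedge (hd as)) = 1"
    using tour_on_start[OF G assms(2) z(1), of 1] by auto
  obtain bs where bs: "tour G bs" "Y = dtail ` set bs" "F = dedge ` set bs"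
    "dtail (hd bs) = z" "colour G (dedge (hd bs)) = 1"
    using tour_on_start[OF G assms(3) z(2), of 1] by auto
  have "tour G (as @ bs)"
    using as bs assms(4) by (auto simp: tour_def successively_append_iff link_def)
  then show ?thesis unfolding tour_on_def using as bs by (intro exI[of _ "as @ bs"]) auto
qed

text \<open>Removing the first edge of a tour leaves an open alternating trail from
  \<open>x'\<close> to \<open>x\<close>; this is the form used for exchanging edges.\<close>

lemma tour_Cons_iff:
  "tour G ((x, e, x') # ds) \<longleftrightarrow>
     ds \<noteq> [] \<and> e \<in> edges G \<and> ends G e = {x, x'} \<and> (\<forall>d\<in>set ds. dart G d) \<and>
     e \<notin> dedge ` set ds \<and> distinct (map dedge ds) \<and> successively (link G) ds \<and>
     dtail (hd ds) = x' \<and> colour G (dedge (hd ds)) \<noteq> colour G e \<and>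
     dhead (last ds) = x \<and> colour G (dedge (last ds)) \<noteq> colour G e"
  by (cases "ds = []") (auto simp: tour_def dart_def link_def successively_Cons)

text \<open>Opening the trails at \<open>e\<close> and \<open>e'\<close> and joining their loose ends by \<open>f\<close> and \<open>f'\<close>.\<close>

lemma tour_on_swap:
  assumes t: "tour_on G X E" "tour_on G Y F" and dis: "E \<inter> F = {}"
    and e: "e \<in> E" "ends G e = {x, x'}" "e' \<in> F" "ends G e' = {y, y'}"
    and f: "f \<in> edges G" "ends G f = {x, y}" "f' \<in> edges G" "ends G f' = {x', y'}" "f \<noteq> f'"
      "f \<notin> E \<union> F" "f' \<notin> E \<union> F"
    and c: "colour G e = c" "colour G e' = c" "colour G f = c" "colour G f' = c"
  shows "\<exists>D. tour_on G (X \<union> Y) D"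
proof -
  obtain as where as: "tour G ((x, e, x') # as)" "X = insert x (dtail ` set as)"
    "E = insert e (dedge ` set as)"
    using tour_on_start_edge[OF t(1) e(1,2)] .
  obtain bs where bs: "tour G ((y', e', y) # bs)" "Y = insert y' (dtail ` set bs)"
    "F = insert e' (dedge ` set bs)"
    using tour_on_start_edge[OF t(2) e(3), of y' y] e(4) by (auto simp: insert_commute)
  note a = as(1)[unfolded tour_Cons_iff] and b = bs(1)[unfolded tour_Cons_iff]
  have sub: "dedge ` set as \<subseteq> E" "dedge ` set bs \<subseteq> F" using as(3) bs(3) by auto
  have dist: "distinct (map dedge as)" "distinct (map dedge bs)" using a b by auto
  \<comment> \<open>\<open>bs\<close> runs from \<open>y\<close> to \<open>y'\<close> and
    \<open>as\<close> from \<open>x'\<close> to \<open>x\<close>. The new edges have the colour of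
    the removed ones, so the colours met at the four ends do not change.\<close>
  let ?ds = "(x, f, y) # bs @ (y', f', x') # as"
  have "tour G ?ds"
    unfolding tour_Cons_iff
  proof (intro conjI)
    show "f \<notin> dedge ` set (bs @ (y', f', x') # as)" using f as(3) bs(3) by auto
    show "distinct (map dedge (bs @ (y', f', x') # as))" using dist sub f(5-7) dis by auto
    show "successively (link G) (bs @ (y', f', x') # as)"
      using a b c by (simp add: successively_append_iff successively_Cons link_def)
    show "\<forall>d\<in>set (bs @ (y', f', x') # as). dart G d" using a b f by (auto simp: dart_def)
  qed (use a b c f in simp_all)
  moreover have "dtail ` set ?ds = X \<union> Y" using as bs by auto
  ultimately show ?thesis unfolding tour_on_def by metis
qed

text \<open>The edge from \<open>y\<close> to \<open>y'\<close> gives way to a path of three edges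
  through \<open>x\<close> and \<open>x'\<close> whose outer edges have its colour. The bound on
  \<open>D\<close> records which edges are spent, for splicing with another tour later.\<close>

lemma tour_on_detour:
  assumes t: "tour_on G Y F"
    and e: "e \<in> F" "ends G e = {y, y'}"
    and f: "f \<in> edges G" "ends G f = {y, x}" "g \<in> edges G" "ends G g = {x, x'}"
      "f' \<in> edges G" "ends G f' = {x', y'}" "distinct [f, g, f']" "f \<notin> F" "g \<notin> F" "f' \<notin> F"
    and c: "colour G e = c" "colour G f = c" "colour G f' = c" "colour G g \<noteq> c"
  shows "\<exists>D. tour_on G ({x, x'} \<union> Y) D \<and> D \<subseteq> {f, g, f'} \<union> F"
proof -
  obtain as where as: "tour G ((y, e, y') # as)" "Y = insert y (dtail ` set as)"
    "F = insert e (dedge ` set as)"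
    using tour_on_start_edge[OF t e(1,2)] .
  note a = as(1)[unfolded tour_Cons_iff]
  let ?ds = "(y, f, x) # (x, g, x') # (x', f', y') # as"
  have "tour G ?ds"
    unfolding tour_Cons_iff
  proof (intro conjI)
    show "f \<notin> dedge ` set ((x, g, x') # (x', f', y') # as)"
      "distinct (map dedge ((x, g, x') # (x', f', y') # as))" using f as(3) a by auto
    show "successively (link G) ((x, g, x') # (x', f', y') # as)"
      using a c by (simp add: successively_Cons link_def)
    show "\<forall>d\<in>set ((x, g, x') # (x', f', y') # as). dart G d" using a f by (auto simp: dart_def)
  qed (use a c f in simp_all)
  moreover have "dtail ` set ?ds = {x, x'} \<union> Y" "dedge ` set ?ds \<subseteq> {f, g, f'} \<union> F"
    using as by auto
  ultimately show ?thesis unfolding tour_on_def by metis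
qed

text \<open>This is what an extension of an M-closed graph retains: two neighbours of \<open>u\<close> in the same colour
  are adjacent or copies of the same vertex, hence twins.\<close>

locale quasi_M_closed =
  fixes G :: "('v, 'e) coloured_graph"
  assumes coloured: "two_edge_coloured_graph G"
    and quasi_closed: "\<And>u x z c. adj G c u x \<Longrightarrow> adj G c u z \<Longrightarrow>
      (\<exists>c'. adj G c' x z) \<or> (\<forall>w c'. adj G c' w x \<longleftrightarrow> adj G c' w z)"
begin

lemma adj_colour: "adj G c x y \<Longrightarrow> c = 1 \<or> c = 2"
  using colour_cases[OF coloured] by (auto simp: adj_def)

end

section \<open>First consequences of two trails having no common spanning tour\<close>

locale unmergeable = quasi_M_closed G for G :: "('v, 'e) coloured_graph" +
  fixes X E Y F
  assumes tX: "tour_on G X E" and tY: "tour_on G Y F" and disj: "X \<inter> Y = {}"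
    and no_merge: "\<And>D. \<not> tour_on G (X \<union> Y) D"
begin

lemma sym: "unmergeable G Y F X E"
  using tX tY disj no_merge
  by unfold_locales (auto simp: Int_commute Un_commute)

lemma ends_X: "e \<in> E \<Longrightarrow> ends G e \<subseteq> X"
  using tour_on_ends[OF tX] by blast

lemma ends_Y: "e \<in> F \<Longrightarrow> ends G e \<subseteq> Y"
  using tour_on_ends[OF tY] by blast

lemma edges_disj: "E \<inter> F = {}"
  using tour_on_ends[OF tX] tour_on_ends[OF tY] disj by blast

lemma cross_edge:
  assumes "ends G e = {x, y}" "x \<in> X" "y \<in> Y"
  shows "e \<notin> E" "e \<notin> F"
  using ends_X[of e] ends_Y[of e] assms disj by auto

text \<open>A tour on fresh edges that meets both \<open>X\<close> and \<open>Y\<close> could be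
  spliced with both trails.\<close>

lemma no_cross_tour:
  assumes t: "tour_on G S D" and "S \<subseteq> X \<union> Y" "S \<inter> X \<noteq> {}" "S \<inter> Y \<noteq> {}"
    and D: "D \<inter> E = {}" "D \<inter> F = {}"
  shows False
proof -
  have "tour_on G (X \<union> S) (E \<union> D)"
    using assms by (intro tour_on_splice[OF coloured tX t]) auto
  then have "tour_on G (X \<union> S \<union> Y) (E \<union> D \<union> F)"
    using assms edges_disj by (intro tour_on_splice[OF coloured _ tY]) auto
  moreover have "X \<union> S \<union> Y = X \<union> Y" using assms by auto
  ultimately show False using no_merge by metis
qed

text \<open>Two parallel edges of different colours form a closed alternating trail of length two,
  which is a cross tour.\<close>

lemma adj_unique:
  assumes "x \<in> X" "y \<in> Y" "adj G c x y" "adj G c' x y"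
  shows "c = c'"
proof (rule ccontr)
  assume "c \<noteq> c'"
  obtain e f where e: "e \<in> edges G" "ends G e = {x, y}" "colour G e = c"
    "f \<in> edges G" "ends G f = {x, y}" "colour G f = c'"
    using assms by (auto simp: adj_def)
  let ?ds = "[(x, e, y), (y, f, x)]"
  have "tour G ?ds" using e \<open>c \<noteq> c'\<close> by (auto simp: tour_def dart_def link_def)
  then have "tour_on G {x, y} {e, f}" unfolding tour_on_def by (intro exI[of _ ?ds]) auto
  moreover have "e \<notin> E \<union> F" "f \<notin> E \<union> F" using cross_edge[OF e(2)] cross_edge[OF e(5)] assms by auto
  ultimately show False using assms by (intro no_cross_tour[of "{x, y}" "{e, f}"]) auto
qed

text \<open>Otherwise \<open>tour_on_swap\<close> merges the trails. The two cross edges are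
  distinct because \<open>e\<close> is not a loop.\<close>

lemma no_swap:
  assumes "e \<in> E" "ends G e = {x, x'}" "e' \<in> F" "ends G e' = {y, y'}"
    and "colour G e = c" "colour G e' = c" "adj G c x y"
  shows "\<not> adj G c x' y'"
proof
  assume "adj G c x' y'"
  with assms obtain f f' where f: "f \<in> edges G" "ends G f = {x, y}" "colour G f = c"
    "f' \<in> edges G" "ends G f' = {x', y'}" "colour G f' = c" by (auto simp: adj_def)
  have xy: "x \<in> X" "x' \<in> X" "y \<in> Y" "y' \<in> Y"
    using ends_X[OF assms(1)] ends_Y[OF assms(3)] assms by auto
  have "card (ends G e) = 2"
    using coloured tX assms(1) tour_on_edges[of G X E e] by (auto simp: two_edge_coloured_graph_def)
  then have "x \<noteq> x'" using assms(2) by auto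
  then have "f \<noteq> f'" using f xy disj by (auto simp: doubleton_eq_iff)
  moreover have "f \<notin> E \<union> F" "f' \<notin> E \<union> F" using cross_edge[OF f(2)] cross_edge[OF f(5)] xy by auto
  ultimately show False
    using tour_on_swap[OF tX tY edges_disj assms(1-4) f(1,2,4,5)] assms f no_merge by blast
qed

text \<open>\<open>x'\<close> and \<open>y\<close> are neighbours of \<open>x\<close> in the same
  colour, so they are adjacent or twins. If they were twins, the edge of that colour from
  \<open>y\<close> to \<open>y'\<close> on the other trail would give such an edge from
  \<open>x'\<close> to \<open>y'\<close>, contrary to \<open>no_swap\<close>.\<close>

lemma adj_next:
  assumes e: "e \<in> E" "ends G e = {x, x'}" and a: "adj G (colour G e) x y" and "y \<in> Y"
  shows "\<exists>c. adj G c x' y"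
proof (rule ccontr)
  assume n: "\<not> ?thesis"
  let ?c = "colour G e"
  have eG: "e \<in> edges G" using tX e(1) by (rule tour_on_edges)
  have "adj G ?c x x'" using e eG by (auto simp: adj_def)
  then have tw: "adj G c' w y \<longleftrightarrow> adj G c' w x'" for w c'
    using quasi_closed[OF _ a, of x'] n by blast
  obtain e' y' where e': "e' \<in> F" "ends G e' = {y, y'}" "colour G e' = ?c" "y' \<in> Y"
    using tour_on_nbr[OF coloured tY \<open>y \<in> Y\<close>, of ?c] colour_cases[OF coloured eG] by blast
  have "adj G ?c y' y" using e' tour_on_edges[OF tY e'(1)] by (auto simp: adj_def)
  then have "adj G ?c x' y'" using tw adj_sym by metis
  with no_swap[OF e e'(1,2) refl e'(3) a] show False by simp
qed

end

section \<open>The edges between two trails that cannot be merged\<close>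

context unmergeable
begin

definition mono :: "'v \<Rightarrow> nat \<Rightarrow> bool" where
  "mono x c \<longleftrightarrow> x \<in> X \<and> (\<forall>y\<in>Y. \<forall>c'. adj G c' x y \<longrightarrow> c' = c) \<and> (\<exists>y\<in>Y. adj G c x y)"

definition nbrs :: "'v \<Rightarrow> 'v set" where
  "nbrs x = {y \<in> Y. \<exists>c. adj G c x y}"

definition full :: "'v \<Rightarrow> nat \<Rightarrow> bool" where
  "full x c \<longleftrightarrow> (\<forall>y\<in>Y. adj G c x y)"

lemma adj_next_Y:
  assumes "f \<in> F" "ends G f = {y, y'}" "adj G (colour G f) x y" "x \<in> X"
  shows "\<exists>c. adj G c x y'"
  using unmergeable.adj_next[OF sym assms(1,2) _ assms(4)] assms(3) adj_sym by metis

lemma opposite_colour: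
  assumes "adj G c x y" "c \<noteq> c'" "c' = 1 \<or> c' = 2"
  shows "c = 3 - c'"
  using adj_colour[OF assms(1)] assms(2,3) by auto

lemma colour_X: "e \<in> E \<Longrightarrow> colour G e = 1 \<or> colour G e = 2"
  using colour_cases[OF coloured tour_on_edges[OF tX]] .

lemma colour_Y: "f \<in> F \<Longrightarrow> colour G f = 1 \<or> colour G f = 2"
  using colour_cases[OF coloured tour_on_edges[OF tY]] .

text \<open>By \<open>adj_next\<close>, \<open>x'\<close> is joined to each \<open>y\<close>. The
  colour of \<open>e\<close> is impossible there: with an \<open>F\<close>-edge of this colour from
  \<open>y\<close> to \<open>y'\<close>, the cross edges \<open>x y'\<close> and \<open>x' y\<close>
  would permit a swap.\<close>

lemma full_step:
  assumes e: "e \<in> E" "ends G e = {x, x'}" and f: "full x (colour G e)"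
  shows "full x' (3 - colour G e)"
  unfolding full_def
proof
  fix y assume y: "y \<in> Y"
  let ?c = "colour G e"
  obtain f y' where f': "f \<in> F" "ends G f = {y, y'}" "colour G f = ?c" "y' \<in> Y"
    using tour_on_nbr[OF coloured tY y, of ?c] colour_X[OF e(1)] by blast
  have a: "adj G ?c x y" "adj G ?c x y'" using f y f'(4) by (auto simp: full_def)
  obtain d where d: "adj G d x' y" using adj_next[OF e a(1) y] by blast
  have "\<not> adj G ?c x' y"
    using no_swap[OF e f'(1), of y' y ?c] f'(2,3) a(2) by (simp add: insert_commute)
  then have "d \<noteq> ?c" using d by blast
  then show "adj G (3 - ?c) x' y" using d opposite_colour colour_X[OF e(1)] by blast
qed

text \<open>The swap argument of \<open>full_step\<close>, confined to \<open>nbrs x\<close>: an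
  \<open>F\<close>-edge of colour \<open>c\<close> at a neighbour of \<open>x\<close> leads to
  another one, which forces colour \<open>3 - c\<close> at \<open>x'\<close>. An edge of colour
  \<open>c\<close> from \<open>x'\<close> to \<open>Y\<close> would carry back along
  \<open>e\<close> and contradict \<open>adj_unique\<close>. In the third claim,
  \<open>F\<close>-edges of colour \<open>c\<close> preserve \<open>nbrs x\<close> and the others
  preserve \<open>nbrs x'\<close>.\<close>

lemma mono_step:
  assumes m: "mono x c" and e: "e \<in> E" "ends G e = {x, x'}" "colour G e = c"
  shows "mono x' (3 - c)" and "nbrs x \<subseteq> nbrs x'"
    and "f \<in> F \<Longrightarrow> ends G f = {y, y'} \<Longrightarrow> y \<in> nbrs x \<Longrightarrow> y' \<in> nbrs x'"
proof -
  have c: "c = 1 \<or> c = 2" using colour_X[OF e(1)] e(3) by simp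
  have x: "x \<in> X" "x' \<in> X" using ends_X[OF e(1)] e(2) by auto
  have mc: "adj G c x y" if "y \<in> nbrs x" for y
    using m that by (auto simp: mono_def nbrs_def)
  have opp: "adj G (3 - c) x' y" if y: "y \<in> nbrs x" for y
  proof -
    have yY: "y \<in> Y" using y by (simp add: nbrs_def)
    obtain f y' where f: "f \<in> F" "ends G f = {y, y'}" "colour G f = c" "y' \<in> Y"
      using tour_on_nbr[OF coloured tY yY, of c] c by blast
    have "\<exists>d. adj G d x y'"
      using adj_next_Y[OF f(1,2) _ x(1)] f(3) mc[OF y] by simp
    then have "y' \<in> nbrs x" using f(4) by (simp add: nbrs_def)
    then have a': "adj G c x y'" by (rule mc)
    obtain d where d: "adj G d x' y" using adj_next[OF e(1,2) _ yY] mc[OF y] e(3) by blast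
    have "\<not> adj G c x' y"
      using no_swap[OF e(1,2) f(1), of y' y c] f(2,3) e(3) a' by (simp add: insert_commute)
    then have "d \<noteq> c" using d by blast
    then show ?thesis using d opposite_colour c by blast
  qed
  have only: "d = 3 - c" if "y \<in> Y" "adj G d x' y" for y d
  proof (cases "d = c")
    case True
    have "\<exists>d. adj G d x y"
      using adj_next[of e x' x y] e that True by (simp add: insert_commute)
    then have "y \<in> nbrs x" using that(1) by (simp add: nbrs_def)
    from adj_unique[OF x(2) that(1) opp[OF this] that(2)] show ?thesis by simp
  next
    case False
    then show ?thesis using opposite_colour[OF that(2)] c by blast
  qed
  have "nbrs x \<noteq> {}" using m by (auto simp: mono_def nbrs_def)
  then have "\<exists>y\<in>Y. adj G (3 - c) x' y" using opp by (auto simp: nbrs_def)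
  then show "mono x' (3 - c)" using x only unfolding mono_def by blast
  show sub: "nbrs x \<subseteq> nbrs x'" using opp by (auto simp: nbrs_def)
  show "y' \<in> nbrs x'" if f: "f \<in> F" "ends G f = {y, y'}" "y \<in> nbrs x"
  proof (cases "colour G f = c")
    case True
    have "\<exists>d. adj G d x y'"
      using adj_next_Y[OF f(1,2) _ x(1)] True mc[OF f(3)] by simp
    then show ?thesis using sub ends_Y[OF f(1)] f(2) by (auto simp: nbrs_def)
  next
    case False
    then have "colour G f = 3 - c" using c colour_Y[OF f(1)] by auto
    then have "\<exists>d. adj G d x' y'"
      using adj_next_Y[OF f(1,2) _ x(2)] opp[OF f(3)] by simp
    then show ?thesis using ends_Y[OF f(1)] f(2) by (auto simp: nbrs_def)
  qed
qed

lemma finite_Y: "finite Y"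
  using tY by (auto simp: tour_on_def)

text \<open>By \<open>mono_step\<close>, the neighbourhoods of monochromatic vertices grow along the trail on \<open>X\<close>;
  where they cannot grow any further, they are closed under the edges of the trail on \<open>Y\<close>.\<close>

lemma mono_imp_full:
  assumes "mono x0 c0"
  shows "\<exists>x c. mono x c \<and> full x c"
proof -
  let ?P = "\<lambda>x. \<exists>c. mono x c"
  have "\<forall>x. ?P x \<longrightarrow> card (nbrs x) < Suc (card Y)"
    using finite_Y by (auto simp: nbrs_def less_Suc_eq_le intro!: card_mono)
  then obtain x where "?P x" and mx: "\<And>x'. ?P x' \<Longrightarrow> card (nbrs x') \<le> card (nbrs x)"
    using ex_has_greatest_nat[of ?P x0 "\<lambda>x. card (nbrs x)" "Suc (card Y)"] assms by blast
  then obtain c where m: "mono x c" by blast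
  have xX: "x \<in> X" and c: "c \<in> {1, 2}" using m adj_colour by (auto simp: mono_def)
  obtain e x' where e: "e \<in> E" "ends G e = {x, x'}" "colour G e = c"
    using tour_on_nbr[OF coloured tX xX c] .
  have "nbrs x' = nbrs x"
    using mono_step(2)[OF m e] mx[OF exI, OF mono_step(1)[OF m e]] finite_Y
    by (intro card_seteq[symmetric]) (auto simp: nbrs_def)
  then have closed: "y' \<in> nbrs x" if "f \<in> F" "ends G f = {y, y'}" "y \<in> nbrs x" for f y y'
    using mono_step(3)[OF m e that] by simp
  obtain y0 where "y0 \<in> Y" "y0 \<in> nbrs x" using m by (auto simp: mono_def nbrs_def)
  \<comment> \<open>The invariant ignores colours, so starting in colour 1 is an arbitrary
    choice.\<close>
  then have "\<forall>y\<in>Y. \<exists>c\<in>{1,2::nat}. y \<in> nbrs x"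
    using closed by (intro tour_on_induct(1)[OF coloured tY, of y0 1 "\<lambda>y c. y \<in> nbrs x"]) auto
  then have "full x c" using m by (auto simp: full_def mono_def nbrs_def)
  with m show ?thesis by blast
qed

text \<open>If no vertex is monochromatic, every vertex meeting a cross edge has one of a prescribed colour,
  1 on \<open>X\<close> and 2 on \<open>Y\<close>. Following these edges closes up to an alternating cycle of cross edges.\<close>

lemma mono_exists:
  assumes "x0 \<in> X" "y0 \<in> Y" "adj G c0 x0 y0"
  shows "(\<exists>x c. mono x c) \<or> (\<exists>y c. unmergeable.mono G Y X y c)"
proof (rule ccontr)
  interpret Y: unmergeable G Y F X E by (rule sym)
  assume n: "\<not> ?thesis"
  \<comment> \<open>The colour in which a vertex is to be left. Cross edges alternate between
    \<open>X\<close> and \<open>Y\<close>, so a walk obeying \<open>?k\<close> alternates in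
    colour.\<close>
  let ?k = "\<lambda>v. if v \<in> X then 1 else 2 :: nat"
  let ?cross = "\<lambda>v w. (v \<in> X \<and> w \<in> Y \<or> v \<in> Y \<and> w \<in> X)"
  let ?V = "{v. \<exists>w c. ?cross v w \<and> adj G c v w}"
  let ?Q = "\<lambda>v p. ?cross v (fst p) \<and> snd p \<in> edges G \<and> ends G (snd p) = {v, fst p} \<and>
    colour G (snd p) = ?k v"
  have "\<forall>v\<in>?V. \<exists>p. ?Q v p"
  proof
    fix v assume "v \<in> ?V"
    obtain w c where w: "?cross v w" "adj G c v w" using \<open>v \<in> ?V\<close> by blast
    have "\<exists>w. ?cross v w \<and> adj G (?k v) v w"
    proof (cases "v \<in> X")
      case True
      then have "w \<in> Y" using w disj by blast
      \<comment> \<open>Otherwise \<open>v\<close> would be monochromatic in colour 2, with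
        \<open>w\<close> as a witness that it has cross edges.\<close>
      with n True w(2) have "\<exists>y\<in>Y. \<exists>c'. adj G c' v y \<and> c' \<noteq> 2"
        unfolding mono_def by metis
      then show ?thesis using True adj_colour by fastforce
    next
      case False
      then have "w \<in> X" "v \<in> Y" using w disj by blast+
      with n w(2) have "\<exists>y\<in>X. \<exists>c'. adj G c' v y \<and> c' \<noteq> 1"
        unfolding Y.mono_def by metis
      then show ?thesis using False \<open>v \<in> Y\<close> adj_colour by fastforce
    qed
    then obtain w e where "?cross v w" "e \<in> edges G" "ends G e = {v, w}" "colour G e = ?k v"
      unfolding adj_def by blast
    then have "?Q v (w, e)" by simp
    then show "\<exists>p. ?Q v p" by blast
  qed
  from bchoice[OF this] obtain p where p: "\<forall>v\<in>?V. ?Q v (p v)" ..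
  define s e where "s v = fst (p v)" and "e v = snd (p v)" for v
  have se: "?cross v (s v) \<and> e v \<in> edges G \<and> ends G (e v) = {v, s v} \<and> colour G (e v) = ?k v"
    if "v \<in> ?V" for v
    using p that by (simp only: s_def e_def)
  have sV: "s v \<in> ?V" if "v \<in> ?V" for v
  proof -
    have "?cross (s v) v \<and> adj G (?k v) (s v) v"
      using se[OF that] unfolding adj_def by (auto simp: insert_commute)
    then show ?thesis by blast
  qed
  define f where "f n = (s ^^ n) x0" for n
  have fV: "f n \<in> ?V" for n
  proof (induction n)
    case 0 show ?case using assms by (auto simp: f_def)
  next
    case (Suc n) then show ?case using sV by (simp add: f_def)
  qed
  have fS: "f (Suc n) = s (f n)" for n by (simp add: f_def)
  have V: "?V \<subseteq> X \<union> Y" by blast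
  have "finite X" using Y.finite_Y .
  have "range f \<subseteq> X \<union> Y" using fV V by blast
  then have "finite (range f)" using finite_Y \<open>finite X\<close> by (metis finite_UnI finite_subset)
  then have "\<not> inj f" using finite_imageD infinite_UNIV_nat by blast
  then have ex: "\<exists>j. \<exists>i<j. f i = f j" unfolding inj_def by (metis nat_neq_iff)
  \<comment> \<open>The first repetition: \<open>f\<close> is injective on \<open>{i..<j}\<close>,
    and the part of the walk before \<open>i\<close> is dropped.\<close>
  define j where "j = (LEAST j. \<exists>i<j. f i = f j)"
  obtain i where i: "i < j" "f i = f j" using LeastI_ex[OF ex] j_def by blast
  have inj: "f a \<noteq> f b" if "a < b" "b < j" for a b
    using not_less_Least[of b "\<lambda>j. \<exists>i<j. f i = f j"] that unfolding j_def by blast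
  have inj': "inj_on f {i..<j}"
    by (rule inj_onI) (metis inj atLeastLessThan_iff nat_neq_iff)
  let ?d = "\<lambda>n. (f n, e (f n), f (Suc n))"
  let ?ds = "map ?d [i..<j]"
  have fe: "e (f n) \<in> edges G" "ends G (e (f n)) = {f n, f (Suc n)}" "colour G (e (f n)) = ?k (f n)"
    and fcross: "?cross (f n) (f (Suc n))" for n
    using se[OF fV[of n]] unfolding fS by blast+
  have alt: "?k (f (Suc n)) \<noteq> ?k (f n)" for n
    using fcross[of n] disj by auto
  have link: "link G (?d n) (?d (Suc n))" for n
    using fe(3)[of n] fe(3)[of "Suc n"] alt[of n] by (simp only: link_def fst_conv snd_conv) simp
  \<comment> \<open>An edge cannot be chosen at both of its ends, since it would need colour 1 at
    one and colour 2 at the other.\<close>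
  have einj: "v = w" if "v \<in> ?V" "w \<in> ?V" "e v = e w" for v w
  proof (rule ccontr)
    assume "v \<noteq> w"
    moreover have "{v, s v} = {w, s w}" using se[OF that(1)] se[OF that(2)] that(3) by metis
    ultimately have "s v = w" by (auto simp: doubleton_eq_iff)
    moreover have "?k v = ?k w" using se[OF that(1)] se[OF that(2)] that(3) by metis
    moreover have "?cross v (s v)" using se[OF that(1)] by (rule conjunct1)
    ultimately have "?cross v w" "?k v = ?k w" by (simp_all only:)
    then show False using disj by (cases "v \<in> X"; cases "w \<in> X") auto
  qed
  have "tour G ?ds"
    unfolding tour_def
  proof (intro conjI)
    show "?ds \<noteq> []" using i by simp
    show "\<forall>d\<in>set ?ds. dart G d" using fe(1,2) by (simp add: dart_def)
    have "inj_on (\<lambda>n. e (f n)) {i..<j}"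
      by (rule inj_onI) (use einj[OF fV fV] inj' in \<open>auto simp: inj_on_def\<close>)
    then show "distinct (map dedge ?ds)" by (simp add: comp_def distinct_map)
    show "successively (link G) ?ds" using link by (auto simp: successively_conv_nth)
    obtain m where m: "j = Suc m" "i \<le> m" using i(1) by (metis Suc_leI less_Suc_eq_le not0_implies_Suc not_less_zero)
    have "?d i = (f j, e (f j), f (Suc i))" using i by simp
    moreover have "link G (?d m) (?d j)" using link[of m] m by simp
    ultimately have "link G (?d m) (?d i)" by (simp add: link_def)
    moreover have "hd ?ds = ?d i" using i(1) by (simp add: hd_map)
    moreover have "last ?ds = ?d m" using m by simp
    ultimately show "link G (last ?ds) (hd ?ds)" by (simp only:)
  qed
  then have "tour_on G (dtail ` set ?ds) (dedge ` set ?ds)" unfolding tour_on_def by blast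
  moreover have "dtail ` set ?ds \<subseteq> X \<union> Y" using \<open>range f \<subseteq> X \<union> Y\<close> by (auto 4 3 dest: subsetD[OF _ rangeI])
  moreover have cr: "?cross (f i) (f (Suc i))" using fcross[of i] .
  moreover have "f i \<in> dtail ` set ?ds" using i(1) by force
  moreover have "f (Suc i) \<in> dtail ` set ?ds"
  proof (cases "Suc i = j")
    case True then show ?thesis using cr i disj by auto
  next
    case False
    then have "Suc i \<in> {i..<j}" using i(1) by simp
    then show ?thesis by force
  qed
  moreover have "d \<notin> E \<and> d \<notin> F" if d: "d \<in> dedge ` set ?ds" for d
  proof -
    obtain n where "d = e (f n)" using d by auto
    then have "ends G d = {f n, f (Suc n)}" using fe(2) by simp
    then show ?thesis
      using fcross[of n] cross_edge[of d "f n" "f (Suc n)"] cross_edge[of d "f (Suc n)" "f n"]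
      by (auto simp: insert_commute)
  qed
  ultimately show False using no_cross_tour[of "dtail ` set ?ds" "dedge ` set ?ds"] by blast
qed

section \<open>One trail controlling the colours of the cross edges\<close>

definition controlled :: "('v \<Rightarrow> nat) \<Rightarrow> bool" where
  "controlled k \<longleftrightarrow> (\<forall>x\<in>X. full x (k x)) \<and>
     (\<forall>e\<in>E. \<forall>x x'. ends G e = {x, x'} \<longrightarrow> k x \<noteq> k x')"

lemma nonempty: "\<exists>x. x \<in> X" "\<exists>y. y \<in> Y"
  using tX tY by (auto simp: tour_on_def tour_def intro: list.set_sel)

lemma full_unique:
  assumes "x \<in> X" "full x c" "full x c'"
  shows "c = c'"
proof -
  obtain y where "y \<in> Y" using nonempty by blast
  then show ?thesis using assms adj_unique unfolding full_def by blast
qed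

lemma full_colour: "full x c \<Longrightarrow> c = 1 \<or> c = 2"
  using nonempty(2) adj_colour unfolding full_def by blast

text \<open>Fullness at one vertex spreads around the trail by \<open>full_step\<close>, switching
  the colour at each edge; \<open>full_unique\<close> makes the colour a function of the
  vertex.\<close>

lemma mono_imp_controlled:
  assumes "mono x0 c0"
  shows "\<exists>k. controlled k"
proof -
  obtain x c where x: "mono x c" "full x c" using mono_imp_full[OF assms] by blast
  have xX: "x \<in> X" using x(1) by (simp add: mono_def)
  have c: "c \<in> {1, 2}" using full_colour[OF x(2)] by blast
  have ind: "\<forall>x\<in>X. \<exists>c\<in>{1, 2}. full x c"
    "\<forall>e\<in>E. \<exists>x x'. ends G e = {x, x'} \<and> full x (colour G e) \<and> full x' (3 - colour G e)"
    by (rule tour_on_induct[OF coloured tX xX c, of full, OF x(2)]; erule full_step; assumption)+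
  have ex: "\<exists>c. full x c" if "x \<in> X" for x using ind(1) that by blast
  define k where "k x = (SOME c. full x c)" for x
  have k: "full x (k x)" if "x \<in> X" for x using someI_ex[OF ex[OF that]] by (simp add: k_def)
  have kx: "k x = c" if "x \<in> X" "full x c" for x c using full_unique[OF that(1) k[OF that(1)] that(2)] .
  have "k a \<noteq> k b" if e: "e \<in> E" "ends G e = {a, b}" for e a b
  proof -
    obtain x x' where x: "ends G e = {x, x'}" "full x (colour G e)" "full x' (3 - colour G e)"
      using ind(2) e(1) by blast
    have "x \<in> X" "x' \<in> X" using ends_X[OF e(1)] x(1) by auto
    then have "k x = colour G e" "k x' = 3 - colour G e" using kx x by blast+
    then have "k x \<noteq> k x'" using colour_X[OF e(1)] by auto
    then show ?thesis using x(1) e(2) by (auto simp: doubleton_eq_iff)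
  qed
  then have "controlled k" using k unfolding controlled_def by blast
  then show ?thesis by blast
qed

lemma controlled_adj: "controlled k \<Longrightarrow> x \<in> X \<Longrightarrow> y \<in> Y \<Longrightarrow> adj G (k x) x y"
  by (simp add: controlled_def full_def)

lemma controlled_colour: "controlled k \<Longrightarrow> x \<in> X \<Longrightarrow> k x = 1 \<or> k x = 2"
  using full_colour[of x "k x"] by (simp add: controlled_def)

lemma controlled_other:
  assumes "controlled k" "x \<in> X"
  obtains x' where "x' \<in> X" "k x' \<noteq> k x"
proof -
  obtain e x' where "e \<in> E" "ends G e = {x, x'}" "x' \<in> X"
    using tour_on_nbr[OF coloured tX assms(2), of 1] by blast
  then show ?thesis using that assms(1) unfolding controlled_def by metis
qed

text \<open>An edge \<open>g\<close> between \<open>x\<close> and \<open>x'\<close> in the other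
  colour is not on the trail of \<open>X\<close>, as \<open>k\<close> changes along trail edges.
  Hence the trail of \<open>Y\<close> can make a detour through \<open>g\<close>; it then meets
  \<open>X\<close> without sharing edges with its trail, and the two splice.\<close>

lemma controlled_inner:
  assumes k: "controlled k" and x: "x \<in> X" "x' \<in> X" "k x = k x'" and a: "adj G c x x'"
  shows "c = k x"
proof (rule ccontr)
  assume n: "c \<noteq> k x"
  obtain g where g: "g \<in> edges G" "ends G g = {x, x'}" "colour G g = c" using a by (auto simp: adj_def)
  have gE: "g \<notin> E" using k x(3) g(2) unfolding controlled_def by blast
  have gF: "g \<notin> F" using ends_Y[of g] g(2) x disj by auto
  have "card (ends G g) = 2" using coloured g(1) by (auto simp: two_edge_coloured_graph_def)
  then have "x \<noteq> x'" using g(2) by auto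
  obtain y where y: "y \<in> Y" using nonempty by blast
  obtain e y' where e: "e \<in> F" "ends G e = {y, y'}" "colour G e = k x" "y' \<in> Y"
    using tour_on_nbr[OF coloured tY y, of "k x"] controlled_colour[OF k x(1)] by blast
  have "adj G (k x) y x" "adj G (k x) x' y'"
    using controlled_adj[OF k x(1) y] controlled_adj[OF k x(2) e(4)] x(3) adj_sym by metis+
  then obtain f f' where f: "f \<in> edges G" "ends G f = {y, x}" "colour G f = k x"
    and f': "f' \<in> edges G" "ends G f' = {x', y'}" "colour G f' = k x"
    unfolding adj_def by blast
  have fc: "f \<notin> E" "f \<notin> F" "f' \<notin> E" "f' \<notin> F"
    using cross_edge[of f x y] cross_edge[of f' x' y'] f(2) f'(2) x y e(4) by (auto simp: insert_commute)
  have "x \<notin> Y" "x' \<notin> Y" using x disj by auto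
  then have "f \<noteq> f'" using f(2) f'(2) \<open>x \<noteq> x'\<close> y e(4) by (auto simp: doubleton_eq_iff)
  moreover have "f \<noteq> g" "g \<noteq> f'" using f(3) f'(3) g(3) n by auto
  ultimately have "distinct [f, g, f']" by simp
  then obtain D where D: "tour_on G ({x, x'} \<union> Y) D" "D \<subseteq> {f, g, f'} \<union> F"
    using tour_on_detour[OF tY e(1,2) f(1,2) g(1,2) f'(1,2) _ fc(2) gF fc(4) e(3) f(3) f'(3)] g(3) n
    by auto
  have "E \<inter> D = {}" using D(2) fc gE edges_disj by auto
  then have "tour_on G (X \<union> ({x, x'} \<union> Y)) (E \<union> D)"
    using x by (intro tour_on_splice[OF coloured tX D(1)]) auto
  moreover have "X \<union> ({x, x'} \<union> Y) = X \<union> Y" using x by auto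
  ultimately show False using no_merge by metis
qed

lemma adj_imp_controlled:
  assumes "x \<in> X" "y \<in> Y" "adj G c x y"
  shows "(\<exists>k. controlled k) \<or> (\<exists>k. unmergeable.controlled G Y F X k)"
  using mono_exists[OF assms] mono_imp_controlled unmergeable.mono_imp_controlled[OF sym] by blast

end

section \<open>Eulerian factors with the least number of parts\<close>

text \<open>The axiom \<open>no_merge\<close> covers every subfamily of at least two parts, because
  the order properties below come from merging three parts at once.\<close>

locale irreducible_factor = quasi_M_closed G for G :: "('v, 'e) coloured_graph" +
  fixes P :: "'v set set" and T :: "'v set \<Rightarrow> 'e set"
  assumes fin: "finite P" and disj: "disjoint P" and cover: "\<Union>P = verts G"
    and tours: "X \<in> P \<Longrightarrow> tour_on G X (T X)"
    and no_merge: "Q \<subseteq> P \<Longrightarrow> 2 \<le> card Q \<Longrightarrow> \<not> tour_on G (\<Union>Q) D"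
begin

lemma parts_disj: "X \<in> P \<Longrightarrow> Y \<in> P \<Longrightarrow> x \<in> X \<Longrightarrow> x \<in> Y \<Longrightarrow> X = Y"
  using disj by (auto simp: disjoint_def)

lemma unmergeable_parts:
  assumes "X \<in> P" "Y \<in> P" "X \<noteq> Y"
  shows "unmergeable G X (T X) Y (T Y)"
proof unfold_locales
  show "X \<inter> Y = {}" using disj assms by (auto simp: disjoint_def)
  show "\<not> tour_on G (X \<union> Y) D" for D using no_merge[of "{X, Y}" D] assms by simp
qed (use tours assms in auto)

text \<open>\<open>ctl X Y k\<close> is \<open>X < Y\<close>, with \<open>k x\<close> the colour of the edges from \<open>x \<in> X\<close> to \<open>Y\<close>.\<close>

definition ctl :: "'v set \<Rightarrow> 'v set \<Rightarrow> ('v \<Rightarrow> nat) \<Rightarrow> bool" where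
  "ctl X Y k \<longleftrightarrow> X \<in> P \<and> Y \<in> P \<and> X \<noteq> Y \<and> unmergeable.controlled G X (T X) Y k"

lemma ctl_unmergeable: "ctl X Y k \<Longrightarrow> unmergeable G X (T X) Y (T Y)"
  by (simp add: ctl_def unmergeable_parts)

lemma ctl_parts: "ctl X Y k \<Longrightarrow> X \<in> P \<and> Y \<in> P \<and> X \<noteq> Y"
  by (simp add: ctl_def)

lemma ctl_controlled: "ctl X Y k \<Longrightarrow> unmergeable.controlled G X (T X) Y k"
  by (simp add: ctl_def)

lemmas ctl_adj = unmergeable.controlled_adj[OF ctl_unmergeable ctl_controlled]
  and ctl_colour = unmergeable.controlled_colour[OF ctl_unmergeable ctl_controlled]
  and ctl_inner = unmergeable.controlled_inner[OF ctl_unmergeable ctl_controlled]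
  and ctl_other = unmergeable.controlled_other[OF ctl_unmergeable ctl_controlled]

lemma ctl_unique: "ctl X Y k \<Longrightarrow> x \<in> X \<Longrightarrow> y \<in> Y \<Longrightarrow> adj G c x y \<Longrightarrow> c = k x"
  using unmergeable.adj_unique[OF ctl_unmergeable _ _ _ ctl_adj] by blast

lemma ctl_both:
  assumes "ctl X Y k" "c = 1 \<or> c = 2"
  obtains x where "x \<in> X" "k x = c"
proof -
  obtain x where x: "x \<in> X" using unmergeable.nonempty(1)[OF ctl_unmergeable[OF assms(1)]] by blast
  obtain x' where x': "x' \<in> X" "k x' \<noteq> k x" using ctl_other[OF assms(1) assms(1) x] .
  then have "k x = c \<or> k x' = c"
    using ctl_colour[OF assms(1) assms(1)] x assms(2) by metis
  then show ?thesis using that x x' by blast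
qed

lemma cross_edge_notin:
  assumes "ends G e = {a, b}" "a \<in> A" "b \<in> B" "A \<in> P" "B \<in> P" "A \<noteq> B" "X \<in> P"
  shows "e \<notin> T X"
proof
  assume "e \<in> T X"
  then have "ends G e \<subseteq> X" using tour_on_ends[OF tours[OF assms(7)]] by blast
  then show False using assms parts_disj by (metis insert_subset)
qed

text \<open>The parts in \<open>Q\<close> are spliced one by one onto the given tour, which meets
  each of them and uses no edge of their trails.\<close>

lemma no_cross_tour:
  assumes t: "tour_on G S D" and Q: "Q \<subseteq> P" "2 \<le> card Q" and S: "S \<subseteq> \<Union>Q" "\<And>X. X \<in> Q \<Longrightarrow> S \<inter> X \<noteq> {}"
    and D: "\<And>X. X \<in> P \<Longrightarrow> D \<inter> T X = {}"
  shows False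
proof -
  have "finite Q" using Q(1) fin finite_subset by blast
  then have "Q \<subseteq> P \<Longrightarrow> (\<And>X. X \<in> Q \<Longrightarrow> S \<inter> X \<noteq> {}) \<Longrightarrow> tour_on G (S \<union> \<Union>Q) (D \<union> \<Union>(T ` Q))"
  proof (induction Q)
    case empty then show ?case using t by simp
  next
    case (insert X Q)
    have "T Y \<inter> T X = {}" if "Y \<in> Q" for Y
      using unmergeable.edges_disj[OF unmergeable_parts, of Y X] insert(2,4) that by auto
    then have "(D \<union> \<Union>(T ` Q)) \<inter> T X = {}" using D[of X] insert(4) by auto
    then have "tour_on G ((S \<union> \<Union>Q) \<union> X) ((D \<union> \<Union>(T ` Q)) \<union> T X)"
    proof (intro tour_on_splice[OF coloured insert(3)] tours)
      show "(S \<union> \<Union>Q) \<inter> X \<noteq> {}" using insert(5)[of X] by auto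
    qed (use insert(4,5) in auto)
    moreover have "(S \<union> \<Union>Q) \<union> X = S \<union> \<Union>(insert X Q)"
      "(D \<union> \<Union>(T ` Q)) \<union> T X = D \<union> \<Union>(T ` insert X Q)" by auto
    ultimately show ?case by metis
  qed
  from this[OF Q(1) S(2)] have "tour_on G (\<Union>Q) (D \<union> \<Union>(T ` Q))"
    using S(1) by (simp add: Un_absorb1)
  then show False using no_merge Q by blast
qed

text \<open>If \<open>k\<close> and \<open>k'\<close> differ at \<open>x\<close>, a trail neighbour
  \<open>x'\<close> has the two values interchanged, and \<open>x y x' z\<close> is a closed
  alternating trail through three parts.\<close>

lemma ctl_consistent:
  assumes k: "ctl X Y k" "ctl X Z k'" and x: "x \<in> X"
  shows "k x = k' x"
proof (cases "Y = Z")
  case True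
  obtain y where "y \<in> Y" using unmergeable.nonempty(2)[OF ctl_unmergeable[OF k(1)]] by blast
  then show ?thesis using ctl_unique[OF k(2) x] ctl_adj[OF k(1) k(1) x] True by metis
next
  case False
  show ?thesis
  proof (rule ccontr)
    assume n: "k x \<noteq> k' x"
    note P = ctl_parts[OF k(1)] ctl_parts[OF k(2)]
    have tX: "tour_on G X (T X)" using tours P by blast
    obtain e x' where e: "e \<in> T X" "ends G e = {x, x'}" "x' \<in> X"
      using tour_on_nbr[OF coloured tX x, of 1] by blast
    have "k x' \<noteq> k x" "k' x' \<noteq> k' x"
      using ctl_controlled[OF k(1)] ctl_controlled[OF k(2)] e
        unmergeable.controlled_def[OF ctl_unmergeable[OF k(1)]]
        unmergeable.controlled_def[OF ctl_unmergeable[OF k(2)]] by metis+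
    then have k': "k x' = k' x" "k' x' = k x"
      using n ctl_colour[OF k(1,1) x] ctl_colour[OF k(2,2) x] ctl_colour[OF k(1,1) e(3)]
        ctl_colour[OF k(2,2) e(3)] by auto
    obtain y z where yz: "y \<in> Y" "z \<in> Z"
      using unmergeable.nonempty(2)[OF ctl_unmergeable[OF k(1)]]
        unmergeable.nonempty(2)[OF ctl_unmergeable[OF k(2)]] by blast
    let ?c = "k x" and ?d = "k' x"
    have "adj G ?c x y" "adj G ?d y x'" "adj G ?c x' z" "adj G ?d z x"
      using ctl_adj[OF k(1,1) x yz(1)] ctl_adj[OF k(1,1) e(3) yz(1)] ctl_adj[OF k(2,2) x yz(2)]
        ctl_adj[OF k(2,2) e(3) yz(2)] k' by (simp_all add: adj_sym)
    then obtain a b c d where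
        a: "a \<in> edges G" "ends G a = {x, y}" "colour G a = ?c"
      and b: "b \<in> edges G" "ends G b = {y, x'}" "colour G b = ?d"
      and c: "c \<in> edges G" "ends G c = {x', z}" "colour G c = ?c"
      and d: "d \<in> edges G" "ends G d = {z, x}" "colour G d = ?d"
      unfolding adj_def by blast
    have ne: "y \<noteq> z" "y \<noteq> x" "z \<noteq> x" "y \<noteq> x'" "z \<noteq> x'"
      using parts_disj P False yz x e(3) by metis+
    have "x \<noteq> x'" using \<open>k x' \<noteq> k x\<close> by auto
    then have dist: "distinct [a, b, c, d]"
      using a(2,3) b(2,3) c(2,3) d(2,3) n ne by (auto simp: doubleton_eq_iff)
    let ?ds = "[(x, a, y), (y, b, x'), (x', c, z), (z, d, x)]"
    have "tour G ?ds" using a b c d n dist by (simp add: tour_def link_def dart_def)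
    then have "tour_on G {x, y, x', z} {a, b, c, d}"
      unfolding tour_on_def by (intro exI[of _ ?ds]) auto
    moreover have "a \<notin> T W \<and> b \<notin> T W \<and> c \<notin> T W \<and> d \<notin> T W" if "W \<in> P" for W
      using cross_edge_notin[OF a(2) x yz(1)] cross_edge_notin[OF b(2) yz(1) e(3)]
        cross_edge_notin[OF c(2) e(3) yz(2)] cross_edge_notin[OF d(2) yz(2) x] P that by metis
    moreover have "2 \<le> card {X, Y, Z}" using P by (simp add: card_insert_if)
    ultimately show False
      using P yz x e(3)
      by (intro no_cross_tour[of "{x, y, x', z}" "{a, b, c, d}" "{X, Y, Z}"])
        (simp_all, auto)
  qed
qed

text \<open>Vertices with \<open>k x = 1\<close> and \<open>k' y = 2\<close> would be joined in both
  colours.\<close>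

lemma ctl_asym:
  assumes "ctl X Y k" "ctl Y X k'"
  shows False
proof -
  obtain x where x: "x \<in> X" "k x = 1" using ctl_both[OF assms(1), of 1] by auto
  obtain y where y: "y \<in> Y" "k' y = 2" using ctl_both[OF assms(2), of 2] by auto
  have "adj G 1 x y" "adj G 2 y x"
    using ctl_adj[OF assms(1,1) x(1) y(1)] ctl_adj[OF assms(2,2) y(1) x(1)] x y by simp_all
  then show False using ctl_unique[OF assms(1) x(1) y(1), of 2] x(2) adj_sym by force
qed

lemma adj_imp_ctl:
  assumes "X \<in> P" "Y \<in> P" "X \<noteq> Y" "x \<in> X" "y \<in> Y" "adj G c x y"
  shows "(\<exists>k. ctl X Y k) \<or> (\<exists>k. ctl Y X k)"
  using unmergeable.adj_imp_controlled[OF unmergeable_parts[OF assms(1-3)] assms(4-6)] assms(1-3)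
  unfolding ctl_def by blast

text \<open>The colour of an edge is set by its end in the controlling part. Going around the three
  parts once gives an odd cycle, so the closed trail goes around twice; the index of a vertex is the
  colour in which it is left.\<close>

lemma no_ctl_triangle:
  assumes "ctl X Y k" "ctl Y Z l" "ctl Z X m"
  shows False
proof -
  note P = ctl_parts[OF assms(1)] ctl_parts[OF assms(2)] ctl_parts[OF assms(3)]
  obtain x1 x2 where x: "x1 \<in> X" "k x1 = 1" "x2 \<in> X" "k x2 = 2"
    using ctl_both[OF assms(1), of 1] ctl_both[OF assms(1), of 2] by metis
  obtain y1 y2 where y: "y1 \<in> Y" "l y1 = 1" "y2 \<in> Y" "l y2 = 2"
    using ctl_both[OF assms(2), of 1] ctl_both[OF assms(2), of 2] by metis
  obtain z1 z2 where z: "z1 \<in> Z" "m z1 = 1" "z2 \<in> Z" "m z2 = 2"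
    using ctl_both[OF assms(3), of 1] ctl_both[OF assms(3), of 2] by metis
  have ne: "x1 \<noteq> x2" "y1 \<noteq> y2" "z1 \<noteq> z2" using x y z by auto
  have ne': "u \<noteq> v" "v \<noteq> w" "w \<noteq> u" if "u \<in> X" "v \<in> Y" "w \<in> Z" for u v w
    using P parts_disj that by metis+
  obtain a where a: "a \<in> edges G" "ends G a = {x1, y2}" "colour G a = 1"
    using ctl_adj[OF assms(1,1) x(1) y(3)] x(2) by (auto simp: adj_def)
  obtain b where b: "b \<in> edges G" "ends G b = {y2, z1}" "colour G b = 2"
    using ctl_adj[OF assms(2,2) y(3) z(1)] y(4) by (auto simp: adj_def)
  obtain c where c: "c \<in> edges G" "ends G c = {z1, x2}" "colour G c = 1"
    using ctl_adj[OF assms(3,3) z(1) x(3)] z(2) by (auto simp: adj_def)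
  obtain d where d: "d \<in> edges G" "ends G d = {x2, y1}" "colour G d = 2"
    using ctl_adj[OF assms(1,1) x(3) y(1)] x(4) by (auto simp: adj_def)
  obtain e where e: "e \<in> edges G" "ends G e = {y1, z2}" "colour G e = 1"
    using ctl_adj[OF assms(2,2) y(1) z(3)] y(2) by (auto simp: adj_def)
  obtain f where f: "f \<in> edges G" "ends G f = {z2, x1}" "colour G f = 2"
    using ctl_adj[OF assms(3,3) z(3) x(1)] z(4) by (auto simp: adj_def)
  have "a \<noteq> c" "a \<noteq> e" "c \<noteq> e" "b \<noteq> d" "b \<noteq> f" "d \<noteq> f"
    using a(2) b(2) c(2) d(2) e(2) f(2) ne ne'[OF x(1) y(1) z(1)] ne'[OF x(3) y(3) z(3)]
    by (auto simp: doubleton_eq_iff)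
  then have dist: "distinct [a, b, c, d, e, f]"
    using a(3) b(3) c(3) d(3) e(3) f(3) by auto
  let ?ds = "[(x1, a, y2), (y2, b, z1), (z1, c, x2), (x2, d, y1), (y1, e, z2), (z2, f, x1)]"
  have "tour G ?ds" using a b c d e f dist by (simp add: tour_def link_def dart_def)
  then have "tour_on G {x1, y2, z1, x2, y1, z2} {a, b, c, d, e, f}"
    unfolding tour_on_def by (intro exI[of _ ?ds]) auto
  moreover have "a \<notin> T W" "b \<notin> T W" "c \<notin> T W" "d \<notin> T W" "e \<notin> T W" "f \<notin> T W" if "W \<in> P" for W
    using cross_edge_notin[OF a(2) x(1) y(3)] cross_edge_notin[OF b(2) y(3) z(1)]
      cross_edge_notin[OF c(2) z(1) x(3)] cross_edge_notin[OF d(2) x(3) y(1)]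
      cross_edge_notin[OF e(2) y(1) z(3)] cross_edge_notin[OF f(2) z(3) x(1)] P that by metis+
  moreover have "2 \<le> card {X, Y, Z}" using P by (simp add: card_insert_if)
  ultimately show False
    using P x(1) y(1) z(1) x(3) y(3) z(3)
    by (intro no_cross_tour[of "{x1, y2, z1, x2, y1, z2}" "{a, b, c, d, e, f}" "{X, Y, Z}"])
      (simp_all, auto)
qed

text \<open>A vertex \<open>x\<close> is joined to \<open>z\<close> and \<open>y\<close> in colour
  1, so these are adjacent or twins; if twins, \<open>z\<close> inherits a neighbour of
  \<open>y\<close> inside \<open>Y\<close>. Thus \<open>Z\<close> and \<open>Y\<close> are
  comparable, and \<open>no_ctl_triangle\<close> excludes that \<open>Y\<close> controls
  \<open>Z\<close>.\<close>

lemma ctl_trans: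
  assumes "ctl Z X m" "ctl X Y k"
  shows "\<exists>l. ctl Z Y l"
proof -
  note P = ctl_parts[OF assms(1)] ctl_parts[OF assms(2)]
  have "Z \<noteq> Y" using ctl_asym assms by blast
  obtain z where z: "z \<in> Z" "m z = 1" using ctl_both[OF assms(1), of 1] by auto
  obtain x where x: "x \<in> X" "k x = 1" using ctl_both[OF assms(2), of 1] by auto
  obtain y where y: "y \<in> Y" using unmergeable.nonempty(2)[OF ctl_unmergeable[OF assms(2)]] by blast
  have "adj G 1 x z" "adj G 1 x y"
    using ctl_adj[OF assms(1,1) z(1) x(1)] ctl_adj[OF assms(2,2) x(1) y] x z adj_sym by metis+
  from quasi_closed[OF this] have "\<exists>c. \<exists>y\<in>Y. adj G c z y"
  proof
    assume tw: "\<forall>w c'. adj G c' w z \<longleftrightarrow> adj G c' w y"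
    have tY: "tour_on G Y (T Y)" using tours P by blast
    obtain e y' where e: "e \<in> T Y" "ends G e = {y, y'}" "y' \<in> Y"
      using tour_on_nbr[OF coloured tY y, of 1] by blast
    then have "adj G (colour G e) y' y"
      using tour_on_edges[OF tY e(1)] by (auto simp: adj_def)
    then show ?thesis using tw e(3) adj_sym by metis
  qed (use y in blast)
  then show ?thesis
    using adj_imp_ctl[of Z Y z] P \<open>Z \<noteq> Y\<close> z(1) no_ctl_triangle[OF assms(2)] assms(1) by blast
qed

lemma minimal_part:
  assumes "P \<noteq> {}"
  obtains X where "X \<in> P" "\<And>Z k. \<not> ctl Z X k"
proof -
  let ?r = "{(X, Y). \<exists>k. ctl X Y k}"
  have "?r \<subseteq> P \<times> P" using ctl_parts by blast
  then have "finite ?r" using fin by (meson finite_SigmaI finite_subset)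
  moreover have "trans ?r" using ctl_trans by (auto intro!: transI)
  moreover have "(X, X) \<notin> ?r" for X using ctl_parts by blast
  ultimately have "wf ?r" by (intro finite_acyclic_wf) (auto simp: acyclic_def trancl_id)
  then show ?thesis using wfE_min[of ?r _ P] assms that ctl_parts by (metis (mono_tags, lifting) case_prod_conv ex_in_conv mem_Collect_eq)
qed

end

section \<open>Alternating trails confined to a minimal part\<close>

lemma alternating_trail_invariant:
  assumes t: "alternating_trail G u v vs es" and "es \<noteq> []"
    and R: "R u (colour G (hd es))"
    and step: "\<And>x c x' c'. R x c \<Longrightarrow> adj G c x x' \<Longrightarrow> x' \<in> X \<and> (c' \<noteq> c \<longrightarrow> R x' c')"
  shows "v \<in> X"
proof -
  have w: "length vs = Suc (length es)" "\<And>i. i < length es \<Longrightarrow> es ! i \<in> edges G"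
    "\<And>i. i < length es \<Longrightarrow> ends G (es ! i) = {vs ! i, vs ! Suc i}"
    "\<And>i. Suc i < length es \<Longrightarrow> colour G (es ! i) \<noteq> colour G (es ! Suc i)" "hd vs = u" "last vs = v"
    using t nth_mem by (fastforce simp: alternating_trail_def trail_def walk_def alternating_def)+
  have a: "adj G (colour G (es ! i)) (vs ! i) (vs ! Suc i)" if "i < length es" for i
    using w(2,3)[OF that] by (auto simp: adj_def)
  \<comment> \<open>\<open>R x c\<close> concerns leaving \<open>x\<close> in colour
    \<open>c\<close>. It makes sense only where a next edge exists, so membership of the final
    vertex in \<open>X\<close> is read off from \<open>step\<close> separately.\<close>
  have inv: "i < length es \<Longrightarrow> R (vs ! i) (colour G (es ! i))" for i
  proof (induction i)
    case 0
    have "vs \<noteq> []" using w(1) by auto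
    then show ?case using R w(5) \<open>es \<noteq> []\<close> by (simp add: hd_conv_nth)
  next
    case (Suc i)
    then show ?case using step[OF _ a[of i]] w(4)[of i] by simp
  qed
  obtain n where n: "length es = Suc n" using \<open>es \<noteq> []\<close> by (cases es) auto
  have "vs ! Suc n \<in> X" using step[OF inv a, of n n] n by simp
  moreover have "vs \<noteq> []" using w(1) by auto
  then have "last vs = vs ! Suc n" using w(1) n by (simp add: last_conv_nth)
  ultimately show ?thesis using w(6) by simp
qed

lemma (in irreducible_factor) connected_imp_single:
  assumes tc: "trail_colour_connected G" and "P \<noteq> {}"
  shows "card P = 1"
proof (rule ccontr)
  assume "card P \<noteq> 1"
  obtain X where X: "X \<in> P" "\<And>Z k. \<not> ctl Z X k" using minimal_part[OF \<open>P \<noteq> {}\<close>] by blast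
  have "P \<noteq> {X}" using \<open>card P \<noteq> 1\<close> by auto
  then obtain Y where Y: "Y \<in> P" "Y \<noteq> X" using X(1) by blast
  have un: "unmergeable G X (T X) Y (T Y)" using unmergeable_parts X(1) Y by blast
  obtain u v where uv: "u \<in> X" "v \<in> Y" using unmergeable.nonempty[OF un] by blast
  then have "v \<notin> X" using parts_disj X(1) Y by blast
  then have "u \<noteq> v" "u \<in> verts G" "v \<in> verts G" using uv cover X(1) Y(1) by auto
  then obtain vs1 es1 vs2 es2 where
      tr: "alternating_trail G u v vs1 es1" "alternating_trail G u v vs2 es2"
        "colour G (hd es1) \<noteq> colour G (hd es2)"
    using tc unfolding trail_colour_connected_def by metis
  have ne: "es \<noteq> []" if "alternating_trail G u v vs es" for vs es
    using that \<open>u \<noteq> v\<close> by (auto simp: alternating_trail_def trail_def walk_def length_Suc_conv)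
  \<comment> \<open>By minimality of \<open>X\<close>, every edge leaving it goes to a part that
    \<open>X\<close> controls.\<close>
  have leave: "\<exists>Z k. ctl X Z k \<and> c = k x" if x: "x \<in> X" "adj G c x x'" "x' \<notin> X" for c x x'
  proof -
    have "x' \<in> verts G" using x(2) coloured by (auto simp: adj_def two_edge_coloured_graph_def)
    then obtain Z where Z: "Z \<in> P" "x' \<in> Z" using cover by blast
    then obtain k where k: "ctl X Z k" using adj_imp_ctl[OF X(1) Z(1) _ x(1) Z(2) x(2)] x(3) X(2) by blast
    then show ?thesis using ctl_unique[OF k x(1) Z(2) x(2)] by blast
  qed
  show False
  proof (cases "\<exists>Z k. ctl X Z k")
    case False
    then have "v \<in> X"
      using leave uv(1)
      by (intro alternating_trail_invariant[OF tr(1) ne[OF tr(1)], of "\<lambda>x c. x \<in> X"]) blast+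
    then show False using \<open>v \<notin> X\<close> by blast
  next
    case True
    then obtain Z k where k: "ctl X Z k" by blast
    let ?R = "\<lambda>x c. x \<in> X \<and> c \<noteq> k x"
    \<comment> \<open>By \<open>leave\<close> and \<open>ctl_consistent\<close>, edges leaving
      \<open>X\<close> at \<open>x\<close> have colour \<open>k x\<close>, so an edge of another
      colour stays inside. By \<open>ctl_inner\<close> it joins vertices with different values of
      \<open>k\<close>, so it arrives at \<open>x'\<close> in colour \<open>k x'\<close> and the
      next edge again avoids that colour.\<close>
    have step: "x' \<in> X \<and> (c' \<noteq> c \<longrightarrow> ?R x' c')" if R: "?R x c" and a: "adj G c x x'" for x c x' c'
    proof -
      have x': "x' \<in> X" using leave[OF _ a] R ctl_consistent[OF k] by metis
      have "k x \<noteq> k x'" using ctl_inner[OF k k _ x' _ a] R by blast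
      moreover have "c = 1 \<or> c = 2" using adj_colour[OF a] .
      ultimately have "c = k x'" using ctl_colour[OF k k] R x' by metis
      then show ?thesis using x' by blast
    qed
    have "v \<in> X" if t: "alternating_trail G u v vs es" and R: "?R u (colour G (hd es))" for vs es
      by (rule alternating_trail_invariant[OF t ne[OF t], of ?R, OF R]; rule step; assumption)
    \<comment> \<open>The two trails leave \<open>u\<close> in different colours, so one of them
      avoids \<open>k u\<close>.\<close>
    moreover have "?R u (colour G (hd es1)) \<or> ?R u (colour G (hd es2))" using tr(3) uv(1) by auto
    ultimately have "v \<in> X" using tr(1,2) by blast
    then show False using \<open>v \<notin> X\<close> by blast
  qed
qed

section \<open>Irreducible factors, and extensions of M-closed graphs\<close>

lemma irreducible_factor_exists:
  assumes q: "quasi_M_closed G" and "eulerian_factor G P0"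
  shows "\<exists>P T. irreducible_factor G P T \<and> P \<noteq> {}"
proof -
  interpret quasi_M_closed G by (rule q)
  obtain P where P: "eulerian_factor G P" "\<And>Q. eulerian_factor G Q \<Longrightarrow> card P \<le> card Q"
    using ex_has_least_nat[of "eulerian_factor G" P0 card] assms(2) by blast
  have sub: "X \<subseteq> verts G" if "X \<in> P" for X using P(1) that by (auto simp: eulerian_factor_def)
  have fp: "finite P" "P \<noteq> {}" "disjoint P" "\<Union>P = verts G" using P(1) by (auto simp: eulerian_factor_def)
  have "\<forall>X\<in>P. \<exists>E. tour_on G X E"
    using P(1) supereulerian_induced_iff[OF coloured sub] by (simp add: eulerian_factor_def)
  from bchoice[OF this] obtain T where T: "\<forall>X\<in>P. tour_on G X (T X)" ..
  have "\<not> tour_on G (\<Union>Q) D" if Q: "Q \<subseteq> P" "2 \<le> card Q" for Q D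
  proof
    assume t: "tour_on G (\<Union>Q) D"
    \<comment> \<open>Replacing the at least two parts in \<open>Q\<close> by their union would give
      an eulerian factor with fewer parts.\<close>
    let ?P = "insert (\<Union>Q) (P - Q)"
    have QP: "\<Union>Q \<subseteq> verts G" using Q(1) fp(4) by blast
    have "finite Q" using Q(1) fp(1) finite_subset by blast
    have dQ: "Z \<inter> \<Union>Q = {}" if "Z \<in> P - Q" for Z
    proof -
      have "Z \<inter> W = {}" if "W \<in> Q" for W
        using disjointD[OF fp(3), of Z W] \<open>Z \<in> P - Q\<close> that Q(1) by blast
      then show ?thesis by blast
    qed
    have dP: "disjoint (P - Q)" using fp(3) by (rule pairwise_subset) blast
    have "eulerian_factor G ?P"
      unfolding eulerian_factor_def
    proof (intro conjI)
      show "finite ?P" "?P \<noteq> {}" using fp by auto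
      show "disjoint ?P"
        using dP dQ unfolding pairwise_insert disjnt_def by (simp only: Int_commute) blast
      show "\<Union>?P = verts G" unfolding fp(4)[symmetric] using Q(1) by blast
      show "\<forall>X\<in>?P. supereulerian (induced_subgraph G X)"
        using P(1) supereulerian_induced_iff[OF coloured QP] t by (auto simp: eulerian_factor_def)
    qed
    then have "card P \<le> card ?P" by (rule P(2))
    also have "\<dots> \<le> Suc (card (P - Q))" by (rule card_insert_le_m1) simp_all
    also have "card (P - Q) = card P - card Q" using Q(1) \<open>finite Q\<close> by (rule card_Diff_subset[rotated])
    finally show False using Q(2) card_mono[OF fp(1) Q(1)] by simp
  qed
  then have "irreducible_factor G P T"
    using fp T by unfold_locales auto
  then show ?thesis using fp(2) by blast
qed

text \<open>Adjacency in \<open>G\<close> depends only on the images under \<pi>. Vertices with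
  equal images are therefore twins; for different images the edge supplied by
  \<open>M_closed\<close> lifts to \<open>G\<close>.\<close>

lemma extension_quasi_M_closed:
  assumes H: "M_closed H" and G: "two_edge_coloured_graph G"
    and ext: "extension_of G H"
  shows "quasi_M_closed G"
proof
  show "two_edge_coloured_graph G" by (rule G)
  obtain \<pi> \<eta> where m: "\<forall>e\<in>edges G. \<eta> e \<in> edges H \<and> \<pi> ` ends G e = ends H (\<eta> e) \<and> colour G e = colour H (\<eta> e)"
    "\<forall>f\<in>edges H. \<forall>x\<in>verts G. \<forall>y\<in>verts G. ends H f = {\<pi> x, \<pi> y} \<longrightarrow>
       (\<exists>!e. e \<in> edges G \<and> \<eta> e = f \<and> ends G e = {x, y})"
    using ext unfolding extension_of_def by (elim conjE exE) (rule that)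
  have proj: "\<eta> e \<in> edges H" "\<pi> ` ends G e = ends H (\<eta> e)" "colour G e = colour H (\<eta> e)"
    if "e \<in> edges G" for e using m(1) that by blast+
  have inst: "\<exists>e. e \<in> edges G \<and> \<eta> e = f \<and> ends G e = {x, y}"
    if "f \<in> edges H" "x \<in> verts G" "y \<in> verts G" "ends H f = {\<pi> x, \<pi> y}" for f x y
    using m(2)[rule_format, OF that] by (rule ex1_implies_ex)
  have V: "x \<in> verts G \<and> y \<in> verts G" if "adj G c x y" for c x y
    using that G by (auto simp: adj_def two_edge_coloured_graph_def)
  have push: "adj H c (\<pi> x) (\<pi> y)" if a: "adj G c x y" for c x y
  proof -
    obtain e where e: "e \<in> edges G" "ends G e = {x, y}" "colour G e = c"
      using a by (auto simp: adj_def)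
    then have "ends H (\<eta> e) = {\<pi> x, \<pi> y}" "colour H (\<eta> e) = c"
      using proj[OF e(1)] by (auto simp flip: proj(2))
    then show ?thesis using proj(1)[OF e(1)] by (auto simp: adj_def)
  qed
  have lift: "adj G c x y" if a: "adj H c (\<pi> x) (\<pi> y)" and xy: "x \<in> verts G" "y \<in> verts G" for c x y
  proof -
    obtain f where f: "f \<in> edges H" "ends H f = {\<pi> x, \<pi> y}" "colour H f = c"
      using a by (auto simp: adj_def)
    obtain e where "e \<in> edges G" "\<eta> e = f" "ends G e = {x, y}" using inst[OF f(1) xy f(2)] by blast
    then show ?thesis using proj(3) f(3) by (auto simp: adj_def)
  qed
  fix u x z c
  assume a: "adj G c u x" "adj G c u z"
  show "(\<exists>c'. adj G c' x z) \<or> (\<forall>w c'. adj G c' w x \<longleftrightarrow> adj G c' w z)"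
  proof (cases "\<pi> x = \<pi> z")
    case True
    then show ?thesis using push lift V a by metis
  next
    case False
    have "\<exists>g\<in>edges H. ends H g = {\<pi> x, \<pi> z}"
      using push[OF a(1)] push[OF a(2)] False H unfolding M_closed_def adj_def by metis
    then have "\<exists>c'. adj H c' (\<pi> x) (\<pi> z)" by (auto simp: adj_def)
    then show ?thesis using lift V a by blast
  qed
qed

theorem theorem28:
  fixes G :: "('v, 'e) coloured_graph" and G\<^sub>0 :: "('w, 'f) coloured_graph"
  assumes "two_edge_coloured_graph G\<^sub>0" and "M_closed G\<^sub>0"
    and "two_edge_coloured_graph G" and "extension_of G G\<^sub>0"
  shows "supereulerian G \<longleftrightarrow> trail_colour_connected G \<and> (\<exists>P. eulerian_factor G P)"
proof
  assume "supereulerian G"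
  then show "trail_colour_connected G \<and> (\<exists>P. eulerian_factor G P)"
    using supereulerian_imp_connected supereulerian_imp_factor assms(3) by blast
next
  assume r: "trail_colour_connected G \<and> (\<exists>P. eulerian_factor G P)"
  then obtain P T where "irreducible_factor G P T" and "P \<noteq> {}"
    using irreducible_factor_exists extension_quasi_M_closed[OF assms(2-4)] by blast
  interpret irreducible_factor G P T by fact
  have "card P = 1" using connected_imp_single r \<open>P \<noteq> {}\<close> by blast
  then obtain X where "P = {X}" by (rule card_1_singletonE)
  then have "tour_on G (verts G) (T X)" using tours cover by auto
  then show "supereulerian G" using supereulerian_iff_tour_on[OF assms(3)] by blast
qed

end
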